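(* Let $\Sigma$ be an arbitrary finite (abstract) simplicial complex. Then there exists a compact manifold with embedded corners $X$ (with all faces connected) such that its corner structure complex $\Sigma_X$ is isomorphic to $\Sigma$ as an abstract simplicial complex.
   Context: A compact smooth manifold with embedded corners $X$ is given by a compact smooth manifold $\widetilde X$ without boundary and smooth maps $\rho_1,\dots,\rho_n\colon\widetilde X\to\mathbb{R}$ such that, with $X:=\bigcap_{j=1}^n\rho_j^{-1}([0,\infty))\subseteq\widetilde X$ (non-empty) and $H_j:=\rho_j^{-1}(0)\cap X$, for every $J\subseteq\{1,\dots,n\}$ the differentials $\{d\rho_j\}_{j\in J}$ have maximal rank $|J|$ (are linearly independent) at each point of $H_J:=\bigcap_{j\in J}H_j$ (with $H_\emptyset:=X$). The dimension of $X$ is $\dim\widetilde X$. The sets $H_j$, which are assumed non-empty, are called the boundary components of codimension $1$; the non-empty $H_J$ with $|J|=k$ are the faces of codimension $k$. Standing assumption: every face of every codimension (including $X$ itself) is connected. An abstract simplicial complex is a vertex set together with a collection of finite subsets of it (the simplices) that is closed under taking subsets and contains the singletons. The corner structure complex $\Sigma_X$ of $X$ is the abstract simplicial complex with vertex set $\{H_1,\dots,H_n\}$ in which $A\subseteq\{H_1,\dots,H_n\}$ is a simplex if and only if $\bigcap_{H\in A}H\neq\emptyset$. *)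

theory Defs
  imports "HOL-Analysis.Analysis" "HOL-Analysis.Abstract_Euclidean_Space"
begin

section \<open>Smooth functions on open subsets of \<open>\<real>\<^sup>d\<close>\<close>

text \<open>The dimension \<open>d\<close> has to be a term, not a type, so that it can be quantified
  existentially. As in \<^theory>\<open>HOL-Analysis.Abstract_Euclidean_Space\<close>, \<open>\<real>\<^sup>d\<close> is the space
  \<^term>\<open>Euclidean_space d\<close> of all functions \<open>nat \<Rightarrow> real\<close> vanishing at every index \<open>\<ge> d\<close>.\<close>

definition partial_deriv :: "nat \<Rightarrow> ((nat \<Rightarrow> real) \<Rightarrow> real) \<Rightarrow> (nat \<Rightarrow> real) \<Rightarrow> real" where
  "partial_deriv i f x = deriv (\<lambda>t. f (x(i := t))) (x i)"

text \<open>\<open>C_on d k S f\<close>: on the open set \<open>S \<subseteq> \<real>\<^sup>d\<close> all partial derivatives of \<open>f\<close> up to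
  order \<open>k\<close> exist and are continuous. The values of \<open>f\<close> off \<open>S\<close> are irrelevant, because \<open>S\<close>
  is open and the \<open>d\<close> coordinate directions stay inside \<open>\<real>\<^sup>d\<close>.\<close>

primrec C_on :: "nat \<Rightarrow> nat \<Rightarrow> (nat \<Rightarrow> real) set \<Rightarrow> ((nat \<Rightarrow> real) \<Rightarrow> real) \<Rightarrow> bool" where
  "C_on d 0 S f \<longleftrightarrow> continuous_map (subtopology (Euclidean_space d) S) euclideanreal f"
| "C_on d (Suc k) S f \<longleftrightarrow>
     continuous_map (subtopology (Euclidean_space d) S) euclideanreal f \<and>
     (\<forall>i<d. (\<forall>x\<in>S. (\<lambda>t. f (x(i := t))) differentiable at (x i)) \<and>
            C_on d k S (partial_deriv i f))"

definition smooth_on :: "nat \<Rightarrow> (nat \<Rightarrow> real) set \<Rightarrow> ((nat \<Rightarrow> real) \<Rightarrow> real) \<Rightarrow> bool" where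
  "smooth_on d S f \<longleftrightarrow> openin (Euclidean_space d) S \<and> (\<forall>k. C_on d k S f)"


section \<open>Smooth manifolds without boundary\<close>

text \<open>A chart is a pair \<open>(U, \<phi>)\<close> of its domain and its coordinate map; only the values of
  \<open>\<phi>\<close> on \<open>U\<close> matter.\<close>

type_synonym 'a chart = "'a set \<times> ('a \<Rightarrow> nat \<Rightarrow> real)"

definition is_chart :: "'a topology \<Rightarrow> nat \<Rightarrow> 'a chart \<Rightarrow> bool" where
  "is_chart M d = (\<lambda>(U, \<phi>). openin M U \<and> openin (Euclidean_space d) (\<phi> ` U) \<and>
     homeomorphic_map (subtopology M U) (subtopology (Euclidean_space d) (\<phi> ` U)) \<phi>)"

text \<open>One direction suffices: it is required below of all ordered pairs of charts.\<close>

definition smooth_transition :: "nat \<Rightarrow> 'a chart \<Rightarrow> 'a chart \<Rightarrow> bool" where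
  "smooth_transition d = (\<lambda>(U, \<phi>) (V, \<psi>).
     \<forall>i<d. smooth_on d (\<phi> ` (U \<inter> V)) (\<lambda>x. \<psi> (inv_into U \<phi> x) i))"

text \<open>The smooth structure is given by a (not necessarily maximal) smooth atlas.\<close>

definition smooth_manifold :: "'a topology \<Rightarrow> nat \<Rightarrow> 'a chart set \<Rightarrow> bool" where
  "smooth_manifold M d \<A> \<longleftrightarrow>
     Hausdorff_space M \<and> second_countable M \<and>
     (\<forall>c\<in>\<A>. is_chart M d c) \<and>
     (\<Union>(U, \<phi>)\<in>\<A>. U) = topspace M \<and>
     (\<forall>c\<in>\<A>. \<forall>c'\<in>\<A>. smooth_transition d c c')"

definition smooth_function :: "nat \<Rightarrow> 'a chart set \<Rightarrow> ('a \<Rightarrow> real) \<Rightarrow> bool" where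
  "smooth_function d \<A> f \<longleftrightarrow> (\<forall>(U, \<phi>)\<in>\<A>. smooth_on d (\<phi> ` U) (f \<circ> inv_into U \<phi>))"

text \<open>The \<open>i\<close>-th coefficient of the differential of \<open>f\<close> at \<open>p\<close> with respect to the basis
  \<open>dx\<^sub>0, \<dots>, dx\<^sub>d\<^sub>-\<^sub>1\<close> of the cotangent space at \<open>p\<close> induced by a chart around \<open>p\<close>.\<close>

definition differential_coeff :: "'a chart \<Rightarrow> ('a \<Rightarrow> real) \<Rightarrow> 'a \<Rightarrow> nat \<Rightarrow> real" where
  "differential_coeff = (\<lambda>(U, \<phi>) f p i. partial_deriv i (f \<circ> inv_into U \<phi>) (\<phi> p))"

text \<open>Linear independence of the family \<open>(d\<rho>\<^sub>j)\<^sub>j\<^sub>\<in>\<^sub>J\<close> at \<open>p\<close>. By the chain rule it does not depend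
  on the chart, so it makes no difference that all charts of the atlas around \<open>p\<close> are used.\<close>

definition differentials_independent_at ::
    "nat \<Rightarrow> 'a chart set \<Rightarrow> (nat \<Rightarrow> 'a \<Rightarrow> real) \<Rightarrow> nat set \<Rightarrow> 'a \<Rightarrow> bool" where
  "differentials_independent_at d \<A> \<rho> J p \<longleftrightarrow>
     (\<forall>c\<in>\<A>. p \<in> fst c \<longrightarrow>
        (\<forall>a :: nat \<Rightarrow> real.
           (\<forall>i<d. (\<Sum>j\<in>J. a j * differential_coeff c (\<rho> j) p i) = 0) \<longrightarrow> (\<forall>j\<in>J. a j = 0)))"


section \<open>Manifolds with embedded corners\<close>

definition corner_domain :: "'a topology \<Rightarrow> nat \<Rightarrow> (nat \<Rightarrow> 'a \<Rightarrow> real) \<Rightarrow> 'a set" where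
  "corner_domain M n \<rho> = topspace M \<inter> (\<Inter>j\<in>{1..n}. \<rho> j -` {0..})"

definition hyperface :: "'a topology \<Rightarrow> nat \<Rightarrow> (nat \<Rightarrow> 'a \<Rightarrow> real) \<Rightarrow> nat \<Rightarrow> 'a set" where
  "hyperface M n \<rho> j = \<rho> j -` {0} \<inter> corner_domain M n \<rho>"

text \<open>The intersection with \<^term>\<open>corner_domain M n \<rho>\<close> only matters for \<open>J = {}\<close>, where it yields
  the convention \<open>H\<^sub>\<emptyset> = X\<close>.\<close>

definition face :: "'a topology \<Rightarrow> nat \<Rightarrow> (nat \<Rightarrow> 'a \<Rightarrow> real) \<Rightarrow> nat set \<Rightarrow> 'a set" where
  "face M n \<rho> J = corner_domain M n \<rho> \<inter> (\<Inter>j\<in>J. hyperface M n \<rho> j)"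

text \<open>The case \<open>n = 0\<close>, where \<open>X\<close> is the closed manifold \<open>M\<close> itself, is included.\<close>

definition compact_manifold_with_embedded_corners ::
    "'a topology \<Rightarrow> nat \<Rightarrow> 'a chart set \<Rightarrow> nat \<Rightarrow> (nat \<Rightarrow> 'a \<Rightarrow> real) \<Rightarrow> bool" where
  "compact_manifold_with_embedded_corners M d \<A> n \<rho> \<longleftrightarrow>
     smooth_manifold M d \<A> \<and> compact_space M \<and>
     (\<forall>j\<in>{1..n}. smooth_function d \<A> (\<rho> j)) \<and>
     corner_domain M n \<rho> \<noteq> {} \<and>
     (\<forall>j\<in>{1..n}. hyperface M n \<rho> j \<noteq> {}) \<and>
     (\<forall>J\<subseteq>{1..n}. \<forall>p\<in>face M n \<rho> J. differentials_independent_at d \<A> \<rho> J p)"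

definition all_faces_connected :: "'a topology \<Rightarrow> nat \<Rightarrow> (nat \<Rightarrow> 'a \<Rightarrow> real) \<Rightarrow> bool" where
  "all_faces_connected M n \<rho> \<longleftrightarrow>
     (\<forall>J\<subseteq>{1..n}. face M n \<rho> J \<noteq> {} \<longrightarrow> connectedin M (face M n \<rho> J))"


section \<open>Abstract simplicial complexes and the corner structure complex\<close>

text \<open>The empty set counts as a simplex. For \<open>V \<noteq> {}\<close> this follows from the other conditions;
  for \<open>V = {}\<close> it singles out \<open>K = {{}}\<close>, which is the corner structure complex of a closed
  manifold.\<close>

definition abstract_simplicial_complex :: "'v set \<Rightarrow> 'v set set \<Rightarrow> bool" where
  "abstract_simplicial_complex V K \<longleftrightarrow>
     (\<forall>A\<in>K. finite A \<and> A \<subseteq> V) \<and>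
     (\<forall>A\<in>K. \<forall>B\<subseteq>A. B \<in> K) \<and>
     {} \<in> K \<and> (\<forall>v\<in>V. {v} \<in> K)"

definition simplicial_isomorphic ::
    "'v set \<Rightarrow> 'v set set \<Rightarrow> 'w set \<Rightarrow> 'w set set \<Rightarrow> bool" where
  "simplicial_isomorphic V K W L \<longleftrightarrow>
     (\<exists>f. bij_betw f V W \<and> (\<forall>A\<subseteq>V. A \<in> K \<longleftrightarrow> f ` A \<in> L))"

definition corner_vertices :: "'a topology \<Rightarrow> nat \<Rightarrow> (nat \<Rightarrow> 'a \<Rightarrow> real) \<Rightarrow> 'a set set" where
  "corner_vertices M n \<rho> = hyperface M n \<rho> ` {1..n}"

text \<open>The intersection is taken inside \<open>X\<close>, so that the empty one is \<open>X\<close>.\<close>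

definition corner_simplices :: "'a topology \<Rightarrow> nat \<Rightarrow> (nat \<Rightarrow> 'a \<Rightarrow> real) \<Rightarrow> 'a set set set" where
  "corner_simplices M n \<rho> =
     {A. A \<subseteq> corner_vertices M n \<rho> \<and> corner_domain M n \<rho> \<inter> \<Inter>A \<noteq> {}}"

end

theory Submission
  imports Defs
begin

text \<open>The vertices are numbered \<open>1, \<dots>, n\<close>, and \<open>L\<close> is the complex on these numbers. The manifold without
  boundary is a level set of a strongly convex function on \<open>\<real>\<^sup>n\<^sup>+\<^sup>2\<close>, whose coordinates are
  \<open>p\<^sub>0, \<dots>, p\<^sub>n\<^sub>+\<^sub>1\<close>:
  \<open>F p = |p|\<^sup>2 + C \<Sum>\<^sub>A exp (- \<lambda> \<Sum>\<^sub>j\<^sub>\<in>\<^sub>A p\<^sub>j) = n + 1\<close>, where \<open>A\<close> runs over the subsets of \<open>{1..n}\<close>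
  that are not simplices. The functions cutting out \<open>X\<close> are the coordinates \<open>p\<^sub>1, \<dots>, p\<^sub>n\<close>.

  If a non-simplex \<open>A\<close> were to meet \<open>X\<close>, that is \<open>p = 0\<close> on \<open>A\<close>, its barrier term would be \<open>C > n + 1\<close>;
  so that face is empty. If \<open>J\<close> is a simplex, let \<open>v\<^sub>J\<close> be \<open>0\<close> on \<open>J\<close> and at the two ends, and \<open>1\<close> elsewhere.
  Every non-simplex leaves \<open>J\<close>, so each barrier term is at most \<open>exp (- \<lambda>)\<close> at \<open>v\<^sub>J\<close>, and for large
  \<open>\<lambda>\<close> the point \<open>v\<^sub>J\<close> lies strictly inside the level set. The rest follows
  from this one inequality (\<open>potential_corner_point\<close>) and convexity. The coordinates \<open>p\<^sub>0\<close> and \<open>p\<^sub>n\<^sub>+\<^sub>1\<close> enter \<open>F\<close> only through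
  their squares, so \<open>v\<^sub>J\<close> can be pushed out to the level set along \<open>p\<^sub>0\<close>; hence the face \<open>J\<close> is
  non-empty. By convexity, at a point \<open>p\<close> of that face the differential of \<open>F\<close> is negative on \<open>v\<^sub>J - p\<close>,
  a vector vanishing on \<open>J\<close>; so some partial derivative of \<open>F\<close> outside \<open>J\<close> is non-zero, which says that
  the \<open>dp\<^sub>j\<close>, \<open>j \<in> J\<close>, stay independent on the level set. Finally each face is swept out by
  rotating a convex set of points \<open>(p\<^sub>1, \<dots>, p\<^sub>n)\<close> in the plane of the two end coordinates, so it is connected.

  Regular level sets are smooth manifolds by the implicit function theorem. Strong convexity, in the
  form \<open>F q \<ge> F p + dF\<^sub>p (q - p) + |q - p|\<^sup>2\<close>, gives a direct proof with finitely many global charts: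
  where \<open>\<partial>\<^sub>kF\<close> has a fixed sign the level set is a graph over the remaining coordinates, and applying the
  inequality to two points of the graph in both orders sandwiches its difference quotients
  (\<open>height_derivative\<close>). All higher derivatives then exist because the partial derivatives of
  the graph are again built from its coordinates by elementary operations
  (\<open>elementary_smooth_on\<close>).\<close>

section \<open>Smoothness by closure under partial derivatives\<close>

text \<open>The functions obtained from generators \<open>G\<close> by the operations below. If the partial derivatives of the
  generators are again of this form, then so are those of all members, which yields smoothness
  without any bookkeeping of higher derivatives. Reciprocals are admitted only for functions without
  zeros on \<open>S\<close>, so that members are continuous and differentiable there.\<close>

inductive_set elementary :: "'a set \<Rightarrow> ('a \<Rightarrow> real) set \<Rightarrow> ('a \<Rightarrow> real) set"
  for S :: "'a set" and G :: "('a \<Rightarrow> real) set" where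
  gen: "g \<in> G \<Longrightarrow> g \<in> elementary S G"
| const: "(\<lambda>x. c) \<in> elementary S G"
| add: "f \<in> elementary S G \<Longrightarrow> g \<in> elementary S G \<Longrightarrow> (\<lambda>x. f x + g x) \<in> elementary S G"
| mult: "f \<in> elementary S G \<Longrightarrow> g \<in> elementary S G \<Longrightarrow> (\<lambda>x. f x * g x) \<in> elementary S G"
| exp: "f \<in> elementary S G \<Longrightarrow> (\<lambda>x. exp (f x)) \<in> elementary S G"
| inverse: "f \<in> elementary S G \<Longrightarrow> (\<And>x. x \<in> S \<Longrightarrow> f x \<noteq> 0)
    \<Longrightarrow> (\<lambda>x. inverse (f x)) \<in> elementary S G"

lemma elementary_sum:
  assumes "\<And>i. i \<in> I \<Longrightarrow> f i \<in> elementary S G"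
  shows "(\<lambda>x. \<Sum>i\<in>I. f i x) \<in> elementary S G"
proof (cases "finite I")
  case True
  then show ?thesis
    using assms by (induction I rule: finite_induct) (auto intro: elementary.intros)
next
  case False
  then show ?thesis by (simp add: elementary.const)
qed

lemma elementary_compose:
  assumes "f \<in> elementary T G" "h ` S \<subseteq> T" and "\<And>g. g \<in> G \<Longrightarrow> (\<lambda>x. g (h x)) \<in> elementary S H"
  shows "(\<lambda>x. f (h x)) \<in> elementary S H"
  using assms(1)
proof induction
  case (inverse f)
  then show ?case using assms(2) by (intro elementary.inverse) auto
qed (use assms(3) in \<open>auto intro: elementary.intros\<close>)

lemma elementary_continuous:
  assumes "f \<in> elementary S G" and "\<And>g. g \<in> G \<Longrightarrow> continuous_on S g"
  shows "continuous_on S f"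
  using assms(1) by induction (use assms(2) in \<open>auto intro!: continuous_intros\<close>)

lemma elementary_partial_derivative:
  assumes gens: "\<And>g. g \<in> G \<Longrightarrow> \<exists>g'\<in>elementary S G.
      \<forall>x\<in>S. ((\<lambda>t. g (x(i := t))) has_real_derivative g' x) (at (x i))"
    and "f \<in> elementary S G"
  shows "\<exists>f'\<in>elementary S G.
      \<forall>x\<in>S. ((\<lambda>t. f (x(i := t))) has_real_derivative f' x) (at (x i))"
  using assms(2)
proof induction
  case (gen g)
  then show ?case by (rule gens)
next
  case (const c)
  show ?case by (intro bexI[of _ "\<lambda>x. 0"]) (auto intro: elementary.const)
next
  case (add f g)
  then obtain f' g' where *:
    "f' \<in> elementary S G" "\<forall>x\<in>S. ((\<lambda>t. f (x(i := t))) has_real_derivative f' x) (at (x i))"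
    "g' \<in> elementary S G" "\<forall>x\<in>S. ((\<lambda>t. g (x(i := t))) has_real_derivative g' x) (at (x i))"
    by blast
  have "((\<lambda>t. f (x(i := t)) + g (x(i := t))) has_real_derivative f' x + g' x) (at (x i))"
    if "x \<in> S" for x
    using DERIV_add[of "\<lambda>t. f (x(i := t))" "f' x" "x i" UNIV "\<lambda>t. g (x(i := t))" "g' x"] * that
    by simp
  then show ?case
    using elementary.add[OF *(1,3)] by (intro bexI[of _ "\<lambda>x. f' x + g' x"] ballI)
next
  case (mult f g)
  then obtain f' g' where *:
    "f' \<in> elementary S G" "\<forall>x\<in>S. ((\<lambda>t. f (x(i := t))) has_real_derivative f' x) (at (x i))"
    "g' \<in> elementary S G" "\<forall>x\<in>S. ((\<lambda>t. g (x(i := t))) has_real_derivative g' x) (at (x i))"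
    by blast
  have "((\<lambda>t. f (x(i := t)) * g (x(i := t))) has_real_derivative f' x * g x + g' x * f x) (at (x i))"
    if "x \<in> S" for x
    using DERIV_mult[of "\<lambda>t. f (x(i := t))" "f' x" "x i" UNIV "\<lambda>t. g (x(i := t))" "g' x"] * that
    by simp
  then show ?case
    using elementary.add[OF elementary.mult[OF *(1) mult(2)] elementary.mult[OF *(3) mult(1)]]
    by (intro bexI[of _ "\<lambda>x. f' x * g x + g' x * f x"] ballI)
next
  case (exp f)
  then obtain f' where *:
    "f' \<in> elementary S G" "\<forall>x\<in>S. ((\<lambda>t. f (x(i := t))) has_real_derivative f' x) (at (x i))"
    by blast
  have "((\<lambda>t. exp (f (x(i := t)))) has_real_derivative exp (f x) * f' x) (at (x i))" if "x \<in> S" for x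
    using DERIV_fun_exp[of "\<lambda>t. f (x(i := t))" "f' x" "x i"] * that by simp
  then show ?case
    using elementary.mult[OF elementary.exp[OF exp(1)] *(1)]
    by (intro bexI[of _ "\<lambda>x. exp (f x) * f' x"] ballI)
next
  case (inverse f)
  then obtain f' where *:
    "f' \<in> elementary S G" "\<forall>x\<in>S. ((\<lambda>t. f (x(i := t))) has_real_derivative f' x) (at (x i))"
    by blast
  have "((\<lambda>t. inverse (f (x(i := t)))) has_real_derivative
      (-1) * (inverse (f x) * f' x * inverse (f x))) (at (x i))" if "x \<in> S" for x
    using DERIV_inverse'[of "\<lambda>t. f (x(i := t))" "f' x" "x i"] * that inverse(2) by simp
  moreover have "(\<lambda>x. inverse (f x)) \<in> elementary S G"
    using inverse(1,2) by (rule elementary.inverse)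
  then have "(\<lambda>x. (-1) * (inverse (f x) * f' x * inverse (f x))) \<in> elementary S G"
    using *(1) by (intro elementary.mult[OF elementary.const] elementary.mult)
  ultimately show ?case
    by (intro bexI[of _ "\<lambda>x. (-1) * (inverse (f x) * f' x * inverse (f x))"] ballI)
qed

lemma Euclidean_space_eq: "Euclidean_space d = top_of_set {x. \<forall>i\<ge>d. x i = 0}"
  by (simp add: Euclidean_space_def euclidean_product_topology)

lemma continuous_on_fun_upd: "continuous_on UNIV (\<lambda>t. (x::nat \<Rightarrow> real)(i := t))"
proof (rule continuous_on_coordinatewise_then_product)
  show "continuous_on UNIV (\<lambda>t. (x(i := t)) j)" for j
    by (cases "j = i") auto
qed

text \<open>Moving one of the first \<open>d\<close> coordinates a little does not leave an open set of \<open>\<real>\<^sup>d\<close>; hence partial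
  derivatives at its points only depend on the values of a function on that set.\<close>

lemma fun_upd_eventually_in_open:
  assumes "openin (Euclidean_space d) S" "x \<in> S" "i < d"
  shows "\<forall>\<^sub>F t in nhds (x i). x(i := t) \<in> S"
proof -
  obtain T where T: "open T" "S = {x. \<forall>i\<ge>d. x i = 0} \<inter> T"
    using assms(1) by (auto simp: Euclidean_space_eq openin_open)
  have "open ((\<lambda>t. x(i := t)) -` T)"
    using T(1) continuous_on_fun_upd by (simp add: continuous_on_open_vimage)
  moreover have "x i \<in> (\<lambda>t. x(i := t)) -` T"
    using assms(2) T by auto
  ultimately have "\<forall>\<^sub>F t in nhds (x i). t \<in> (\<lambda>t. x(i := t)) -` T"
    by (rule eventually_nhds_in_open)
  then show ?thesis
    by eventually_elim (use T assms in auto)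
qed

text \<open>Induction on the order of differentiation: on \<open>S\<close> a partial derivative of a member is again a member. The
  function \<open>f\<close> only agrees with a member on \<open>S\<close>, because chart inverses are unspecified elsewhere.\<close>

lemma elementary_smooth_on:
  assumes "\<And>g. g \<in> G \<Longrightarrow> continuous_on W g"
    and "\<And>g i. g \<in> G \<Longrightarrow> i < d \<Longrightarrow> \<exists>g'\<in>elementary W G.
      \<forall>x\<in>W. ((\<lambda>t. g (x(i := t))) has_real_derivative g' x) (at (x i))"
    and "g \<in> elementary W G" "S \<subseteq> W" and S: "openin (Euclidean_space d) S"
    and "\<And>x. x \<in> S \<Longrightarrow> f x = g x"
  shows "smooth_on d S f"
proof -
  have sub: "subtopology (Euclidean_space d) S = top_of_set S"
    using openin_subset[OF S]
    by (simp add: Euclidean_space_eq subtopology_subtopology Int_absorb1)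
  have "C_on d k S f" if "g \<in> elementary W G" "\<And>x. x \<in> S \<Longrightarrow> f x = g x" for k f g
    using that
  proof (induction k arbitrary: f g)
    case 0
    then show ?case
      using elementary_continuous[OF 0(1) assms(1)] assms(4)
      by (simp add: sub) (metis continuous_on_cong continuous_on_subset)
  next
    case (Suc k)
    have "continuous_on S f"
      using elementary_continuous[OF Suc(2) assms(1)] assms(4) Suc(3)
      by (metis continuous_on_cong continuous_on_subset)
    moreover have "(\<forall>x\<in>S. (\<lambda>t. f (x(i := t))) differentiable at (x i)) \<and>
      C_on d k S (partial_deriv i f)" if "i < d" for i
    proof -
      obtain g' where g': "g' \<in> elementary W G"
        "\<forall>x\<in>W. ((\<lambda>t. g (x(i := t))) has_real_derivative g' x) (at (x i))"
        using elementary_partial_derivative[OF assms(2)[OF _ \<open>i < d\<close>] Suc(2)] by blast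
      have D: "((\<lambda>t. f (x(i := t))) has_real_derivative g' x) (at (x i))" if "x \<in> S" for x
      proof -
        have "\<forall>\<^sub>F t in nhds (x i). f (x(i := t)) = g (x(i := t))"
          using fun_upd_eventually_in_open[OF S that \<open>i < d\<close>]
          by eventually_elim (use Suc(3) in auto)
        then show ?thesis
          using DERIV_cong_ev[of "x i" "x i" "\<lambda>t. f (x(i := t))" "\<lambda>t. g (x(i := t))" "g' x" "g' x"]
            g'(2) that assms(4) by auto
      qed
      then have "\<And>x. x \<in> S \<Longrightarrow> partial_deriv i f x = g' x"
        by (auto simp: partial_deriv_def intro!: DERIV_imp_deriv)
      then show ?thesis
        using D Suc.IH[OF g'(1)] by (auto simp: real_differentiable_def)
    qed
    ultimately show ?case
      by (simp add: sub)
  qed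
  then show ?thesis
    using assms(3,6) S by (auto simp: smooth_on_def)
qed

section \<open>Two facts about the product topology\<close>

lemma second_countable_euclidean:
  "second_countable (euclidean :: 'a::second_countable_topology topology)"
proof -
  obtain B :: "'a set set" where B: "countable B" "\<And>C. C \<in> B \<Longrightarrow> open C"
    "\<And>S. open S \<Longrightarrow> \<exists>U. U \<subseteq> B \<and> S = \<Union>U"
    using univ_second_countable by blast
  have "\<exists>V\<in>B. x \<in> V \<and> V \<subseteq> S" if "open S" "x \<in> S" for x S
    using B(3)[OF that(1)] that(2) by blast
  then show ?thesis
    unfolding second_countable_def using B(1,2) by (intro exI[of _ B]) auto
qed

lemma compact_cube: "compact {p :: nat \<Rightarrow> real. \<forall>i. \<bar>p i\<bar> \<le> c}"
proof -
  have "{p :: nat \<Rightarrow> real. \<forall>i. \<bar>p i\<bar> \<le> c} = PiE UNIV (\<lambda>_. {-c..c})"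
    by (auto simp: PiE_UNIV_domain abs_le_iff minus_le_iff Pi_iff)
  moreover have "compactin (product_topology (\<lambda>_. euclideanreal) UNIV) (PiE (UNIV :: nat set) (\<lambda>_. {-c..c}))"
    by (simp add: compactin_PiE)
  ultimately show ?thesis
    by (simp add: euclidean_product_topology)
qed

section \<open>Inserting and dropping a coordinate\<close>

definition insert_coord :: "nat \<Rightarrow> real \<Rightarrow> (nat \<Rightarrow> real) \<Rightarrow> nat \<Rightarrow> real" where
  "insert_coord k t x = (\<lambda>i. if i < k then x i else if i = k then t else x (i - 1))"

definition drop_coord :: "nat \<Rightarrow> (nat \<Rightarrow> real) \<Rightarrow> nat \<Rightarrow> real" where
  "drop_coord k p = (\<lambda>i. if i < k then p i else p (Suc i))"

text \<open>The index in \<open>\<real>\<^sup>d\<^sup>+\<^sup>1\<close> of the \<open>i\<close>-th coordinate that remains when coordinate \<open>k\<close> is dropped.\<close>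

definition skip :: "nat \<Rightarrow> nat \<Rightarrow> nat" where
  "skip k i = (if i < k then i else Suc i)"

lemma drop_coord_insert_coord [simp]: "drop_coord k (insert_coord k t x) = x"
  by (auto simp: drop_coord_def insert_coord_def)

lemma insert_coord_drop_coord [simp]: "insert_coord k (p k) (drop_coord k p) = p"
  by (auto simp: drop_coord_def insert_coord_def fun_eq_iff)

lemma insert_coord_same [simp]: "insert_coord k t x k = t"
  by (simp add: insert_coord_def)

lemma insert_coord_skip [simp]: "insert_coord k t x (skip k i) = x i"
  by (simp add: insert_coord_def skip_def)

lemma skip_neq [simp]: "skip k i \<noteq> k"
  by (simp add: skip_def)

lemma skip_surj:
  assumes "j \<noteq> k" "j \<le> d" "k \<le> d"
  obtains i where "i < d" "j = skip k i"
  using assms by (cases "j < k") (auto simp: skip_def intro: that[of j] that[of "j - 1"])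

lemma skip_le: "i < d \<Longrightarrow> skip k i \<le> d"
  by (simp add: skip_def)

lemma insert_coord_upd: "insert_coord k t (x(i := u)) = (insert_coord k t x)(skip k i := u)"
  by (auto simp: insert_coord_def skip_def fun_eq_iff)

lemma continuous_on_insert_coord [continuous_intros]:
  assumes "continuous_on S f" "continuous_on S g"
  shows "continuous_on S (\<lambda>x. insert_coord k (f x) (g x))"
proof (rule continuous_on_coordinatewise_then_product)
  show "continuous_on S (\<lambda>x. insert_coord k (f x) (g x) i)" for i
    using assms continuous_on_product_then_coordinatewise[OF assms(2)]
    by (cases "i < k"; cases "i = k") (simp_all add: insert_coord_def)
qed

lemma continuous_on_drop_coord: "continuous_on S (drop_coord k)"
proof (rule continuous_on_coordinatewise_then_product)
  show "continuous_on S (\<lambda>x. drop_coord k x i)" for i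
    by (cases "i < k") (simp_all add: drop_coord_def continuous_on_subset[OF continuous_on_product_coordinates])
qed

lemma insert_coord_outside: "k \<le> d \<Longrightarrow> \<forall>i\<ge>d. x i = 0 \<Longrightarrow> \<forall>i>d. insert_coord k t x i = 0"
  by (auto simp: insert_coord_def)

lemma drop_coord_outside: "k \<le> d \<Longrightarrow> \<forall>i>d. p i = 0 \<Longrightarrow> \<forall>i\<ge>d. drop_coord k p i = 0"
  by (auto simp: drop_coord_def)

section \<open>Level sets of strongly convex functions\<close>

text \<open>A function \<open>F\<close> on \<open>\<real>\<^sup>d\<^sup>+\<^sup>1\<close> with gradient \<open>D\<close>. All that links \<open>D\<close> to \<open>F\<close> is
  \<open>strong_convexity\<close>: the tangent hyperplane at \<open>p\<close> lies below the graph of \<open>F\<close>, with a quadratic gap. Together with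
  continuity it identifies \<open>D i\<close> as the \<open>i\<close>-th partial derivative. The interior point excludes an empty level set and
  one that consists only of the minimum.\<close>

locale convex_hypersurface =
  fixes d :: nat and F :: "(nat \<Rightarrow> real) \<Rightarrow> real" and D :: "nat \<Rightarrow> (nat \<Rightarrow> real) \<Rightarrow> real" and R :: real
  assumes continuous_F: "continuous_on UNIV F"
    and elementary_D: "i \<le> d \<Longrightarrow> D i \<in> elementary UNIV (range (\<lambda>j p. p j))"
    and strong_convexity:
      "F p + (\<Sum>i\<le>d. D i p * (q i - p i)) + (\<Sum>i\<le>d. (q i - p i)\<^sup>2) \<le> F q"
    and coercive: "(\<Sum>i\<le>d. (p i)\<^sup>2) \<le> F p"
    and inner_point: "\<exists>p. F p < R"
begin

lemma continuous_D: "i \<le> d \<Longrightarrow> continuous_on UNIV (D i)"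
  by (rule elementary_continuous[OF elementary_D]) auto

lemma line_convexity:
  assumes "k \<le> d"
  shows "F (insert_coord k s x) + D k (insert_coord k s x) * (t - s) + (t - s)\<^sup>2
    \<le> F (insert_coord k t x)"
proof -
  let ?p = "insert_coord k s x" and ?q = "insert_coord k t x"
  have diff: "?q i - ?p i = (if i = k then t - s else 0)" for i
    by (auto simp: insert_coord_def)
  have "(\<Sum>i\<le>d. D i ?p * (?q i - ?p i)) = (\<Sum>i\<le>d. if i = k then D k ?p * (t - s) else 0)"
    "(\<Sum>i\<le>d. (?q i - ?p i)\<^sup>2) = (\<Sum>i\<le>d. if i = k then (t - s)\<^sup>2 else 0)"
    unfolding diff by (intro sum.cong; simp)+
  then show ?thesis
    using strong_convexity[of ?p ?q] assms by simp
qed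

lemma plane_convexity:
  assumes "k \<le> d" "l \<le> d" "k \<noteq> l" "\<And>i. i \<noteq> k \<Longrightarrow> i \<noteq> l \<Longrightarrow> q i = p i"
  shows "F p + D k p * (q k - p k) + D l p * (q l - p l) \<le> F q"
proof -
  have "(\<Sum>i\<le>d. D i p * (q i - p i)) = (\<Sum>i\<in>{k, l}. D i p * (q i - p i))"
    using assms by (intro sum.mono_neutral_right) auto
  also have "\<dots> = D k p * (q k - p k) + D l p * (q l - p l)"
    using assms by simp
  moreover have "0 \<le> (\<Sum>i\<le>d. (q i - p i)\<^sup>2)"
    by (intro sum_nonneg) auto
  ultimately show ?thesis
    using strong_convexity[of p q] by linarith
qed

definition hypersurface :: "(nat \<Rightarrow> real) set" where
  "hypersurface = {p. (\<forall>i>d. p i = 0) \<and> F p = R}"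

text \<open>The sign \<open>e \<in> {1, -1}\<close> selects one of the two sheets of the level set that are graphs over the
  coordinates other than \<open>k\<close>; the points between them, where \<open>D k p = 0\<close>, are covered by other values of \<open>k\<close>.\<close>

definition chart_domain :: "nat \<Rightarrow> real \<Rightarrow> (nat \<Rightarrow> real) set" where
  "chart_domain k e = {p \<in> hypersurface. 0 < e * D k p}"

text \<open>A line in direction \<open>k\<close> crosses the level set transversally iff it meets its interior, by convexity. So
  both sheets have the same projection, and this description makes its openness evident.\<close>

definition shadow :: "nat \<Rightarrow> (nat \<Rightarrow> real) set" where
  "shadow k = {x. (\<forall>i\<ge>d. x i = 0) \<and> (\<exists>t. F (insert_coord k t x) < R)}"

definition height :: "nat \<Rightarrow> real \<Rightarrow> (nat \<Rightarrow> real) \<Rightarrow> real" where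
  "height k e x = (THE t. F (insert_coord k t x) = R \<and> 0 < e * D k (insert_coord k t x))"

abbreviation graph :: "nat \<Rightarrow> real \<Rightarrow> (nat \<Rightarrow> real) \<Rightarrow> nat \<Rightarrow> real" where
  "graph k e x \<equiv> insert_coord k (height k e x) x"

text \<open>Tangent hyperplane inequality at the boundary point \<open>s\<close>: as seen along a line, the whole sublevel set lies on the
  side opposite to the gradient.\<close>

lemma inside_below_height:
  assumes "k \<le> d" "e = 1 \<or> e = -1" "F (insert_coord k s x) = R" "0 < e * D k (insert_coord k s x)"
    and "F (insert_coord k t x) \<le> R" "t \<noteq> s"
  shows "0 < e * (s - t)"
proof -
  have "0 < (t - s)\<^sup>2"
    using assms by simp
  then have "D k (insert_coord k s x) * (t - s) < 0"
    using line_convexity[OF assms(1), of s x t] assms(3,5) by linarith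
  then show ?thesis
    using assms(2,4) by (elim disjE) (simp_all add: mult_less_0_iff)
qed

lemma height_unique:
  assumes "k \<le> d" "e = 1 \<or> e = -1"
    and "F (insert_coord k s x) = R" "0 < e * D k (insert_coord k s x)"
    and "F (insert_coord k t x) = R" "0 < e * D k (insert_coord k t x)"
  shows "s = t"
proof (rule ccontr)
  assume "s \<noteq> t"
  then have "0 < e * (s - t)" "0 < e * (t - s)"
    using inside_below_height[OF assms(1,2)] assms(3-) by auto
  then show False
    by (simp add: algebra_simps)
qed

lemma height_eq:
  assumes "k \<le> d" "e = 1 \<or> e = -1"
    and "F (insert_coord k s x) = R" "0 < e * D k (insert_coord k s x)"
  shows "height k e x = s"
  unfolding height_def
proof (rule the_equality)
  show "F (insert_coord k s x) = R \<and> 0 < e * D k (insert_coord k s x)"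
    using assms(3,4) by simp
  show "t = s" if "F (insert_coord k t x) = R \<and> 0 < e * D k (insert_coord k t x)" for t
    using height_unique[OF assms(1,2), of t x s] assms(3,4) that by blast
qed

text \<open>Starting from an interior point, \<open>F\<close> grows beyond \<open>R\<close> in direction \<open>e\<close> by coercivity, so the level is
  attained; the tangent inequality towards the interior point fixes the sign of the slope there.\<close>

lemma height_exists:
  assumes k: "k \<le> d" and e: "e = 1 \<or> e = -1" and t: "F (insert_coord k t x) < R"
  shows "\<exists>s. F (insert_coord k s x) = R \<and> 0 < e * D k (insert_coord k s x)"
proof -
  let ?G = "\<lambda>u. F (insert_coord k (t + e * u) x)"
  (* far enough that the k-th coordinate has absolute value at least |R| + 1 > sqrt R *)
  define c where "c = \<bar>t\<bar> + \<bar>R\<bar> + 1"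
  have "c \<ge> 0" by (simp add: c_def)
  have "R \<le> ?G c"
  proof -
    have "\<bar>R\<bar> + 1 \<le> \<bar>t + e * c\<bar>"
      using e by (auto simp: c_def)
    then have "(\<bar>R\<bar> + 1)\<^sup>2 \<le> (t + e * c)\<^sup>2"
      by (metis abs_ge_zero add_increasing2 power2_abs power_mono zero_le_one)
    moreover have "(\<bar>R\<bar> + 1)\<^sup>2 = R\<^sup>2 + 2 * \<bar>R\<bar> + 1"
      by (simp add: power2_sum)
    then have "R \<le> (\<bar>R\<bar> + 1)\<^sup>2"
      using zero_le_power2[of R] by linarith
    moreover have "(t + e * c)\<^sup>2 \<le> (\<Sum>i\<le>d. (insert_coord k (t + e * c) x i)\<^sup>2)"
      using member_le_sum[of k "{..d}" "\<lambda>i. (insert_coord k (t + e * c) x i)\<^sup>2"] k by simp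
    ultimately show ?thesis
      using coercive[of "insert_coord k (t + e * c) x"] by linarith
  qed
  moreover have "continuous_on {0..c} ?G"
    by (intro continuous_on_compose2[OF continuous_F] continuous_intros) auto
  ultimately obtain u where u: "0 \<le> u" "u \<le> c" "?G u = R"
    using IVT'[of ?G 0 R c] t \<open>c \<ge> 0\<close> by auto
  with t have "u > 0" by (cases "u = 0") auto
  have "?G u + D k (insert_coord k (t + e * u) x) * (- (e * u)) + (e * u)\<^sup>2 < R"
    using line_convexity[OF k, of "t + e * u" x t] t by simp
  then have "D k (insert_coord k (t + e * u) x) * (- (e * u)) < 0"
    using u(3) zero_le_power2[of "e * u"] by linarith
  then have "0 < (e * D k (insert_coord k (t + e * u) x)) * u"
    by (simp add: algebra_simps)
  then show ?thesis
    using u(3) \<open>u > 0\<close> by (intro exI[of _ "t + e * u"]) (simp add: zero_less_mult_iff)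
qed

text \<open>Just below the sheet one is inside the level set. Continuity of the slope is needed: convexity bounds \<open>F\<close>
  from above at \<open>s - e * \<delta>\<close> only through the slope at that point.\<close>

lemma points_below_height:
  assumes k: "k \<le> d" and e: "e = 1 \<or> e = -1"
    and s: "F (insert_coord k s x) = R" "0 < e * D k (insert_coord k s x)" and "\<epsilon> > 0"
  obtains \<delta> where "0 < \<delta>" "\<delta> < \<epsilon>" "F (insert_coord k (s - e * \<delta>) x) < R"
proof -
  have "continuous_on UNIV (\<lambda>u. e * D k (insert_coord k (s - e * u) x))"
    by (intro continuous_intros continuous_on_compose2[OF continuous_D[OF k]]) auto
  then have "((\<lambda>u. e * D k (insert_coord k (s - e * u) x)) \<longlongrightarrow> e * D k (insert_coord k (s - e * 0) x)) (at 0)"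
    unfolding continuous_on_def by blast
  then have "\<forall>\<^sub>F u in at 0. 0 < e * D k (insert_coord k (s - e * u) x)"
    using s(2) order_tendstoD(1) by fastforce
  then have "\<forall>\<^sub>F u in at_right 0. 0 < e * D k (insert_coord k (s - e * u) x)"
    by (simp add: eventually_at_split)
  moreover have "\<forall>\<^sub>F u in at_right 0. u \<in> {0<..<\<epsilon>}"
    using \<open>\<epsilon> > 0\<close> by (rule eventually_at_right_real)
  ultimately have "\<forall>\<^sub>F u in at_right 0. u \<in> {0<..<\<epsilon>} \<and> 0 < e * D k (insert_coord k (s - e * u) x)"
    by eventually_elim auto
  then obtain \<delta> where \<delta>: "0 < \<delta>" "\<delta> < \<epsilon>" "0 < e * D k (insert_coord k (s - e * \<delta>) x)"
    using eventually_happens by (metis (no_types, lifting) greaterThanLessThan_iff trivial_limit_at_right_real)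
  have "0 < (e * D k (insert_coord k (s - e * \<delta>) x)) * \<delta>"
    using \<delta> by simp
  then have "0 < D k (insert_coord k (s - e * \<delta>) x) * (s - (s - e * \<delta>))"
    by (simp add: mult_ac)
  then have "F (insert_coord k (s - e * \<delta>) x) < R"
    using line_convexity[OF k, of "s - e * \<delta>" x s] s(1) zero_le_power2[of "s - (s - e * \<delta>)"]
    by linarith
  then show ?thesis
    using that \<delta> by blast
qed

lemma graph_properties:
  assumes "k \<le> d" "e = 1 \<or> e = -1" "x \<in> shadow k"
  shows "F (graph k e x) = R" "0 < e * D k (graph k e x)"
proof -
  obtain s where "F (insert_coord k s x) = R" "0 < e * D k (insert_coord k s x)"
    using height_exists[OF assms(1,2)] assms(3) unfolding shadow_def by blast
  then show "F (graph k e x) = R" "0 < e * D k (graph k e x)"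
    using height_eq[OF assms(1,2)] by simp_all
qed

lemma graph_in_chart_domain:
  assumes "k \<le> d" "e = 1 \<or> e = -1" "x \<in> shadow k"
  shows "graph k e x \<in> chart_domain k e"
proof -
  have "\<forall>i>d. graph k e x i = 0"
    using insert_coord_outside assms by (simp add: shadow_def)
  then show ?thesis
    using graph_properties[OF assms] by (simp add: chart_domain_def hypersurface_def)
qed

lemma drop_coord_chart_domain:
  assumes "k \<le> d" "e = 1 \<or> e = -1" "p \<in> chart_domain k e"
  shows "drop_coord k p \<in> shadow k" "graph k e (drop_coord k p) = p"
proof -
  have p: "\<forall>i>d. p i = 0" "F p = R" "0 < e * D k p"
    using assms by (auto simp: chart_domain_def hypersurface_def)
  have "\<exists>t. F (insert_coord k t (drop_coord k p)) < R"
    using points_below_height[of k e "p k" "drop_coord k p" 1] assms(1,2) p by auto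
  then show "drop_coord k p \<in> shadow k"
    using drop_coord_outside assms(1) p by (simp add: shadow_def)
  show "graph k e (drop_coord k p) = p"
    using height_eq[of k e "p k" "drop_coord k p"] assms(1,2) p by simp
qed

lemma image_drop_coord:
  assumes "k \<le> d" "e = 1 \<or> e = -1"
  shows "drop_coord k ` chart_domain k e = shadow k"
proof
  show "drop_coord k ` chart_domain k e \<subseteq> shadow k"
    using drop_coord_chart_domain[OF assms] by auto
  show "shadow k \<subseteq> drop_coord k ` chart_domain k e"
  proof
    fix x assume "x \<in> shadow k"
    then show "x \<in> drop_coord k ` chart_domain k e"
      using graph_in_chart_domain[OF assms] by (intro image_eqI[of x _ "graph k e x"]) simp_all
  qed
qed

lemma inj_on_drop_coord:
  assumes "k \<le> d" "e = 1 \<or> e = -1"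
  shows "inj_on (drop_coord k) (chart_domain k e)"
  by (rule inj_on_inverseI[of _ "graph k e"]) (rule drop_coord_chart_domain(2)[OF assms])

lemma inv_drop_coord:
  assumes "k \<le> d" "e = 1 \<or> e = -1" "x \<in> shadow k"
  shows "inv_into (chart_domain k e) (drop_coord k) x = graph k e x"
  using inv_into_f_eq[OF inj_on_drop_coord graph_in_chart_domain] assms by simp

lemma openin_shadow: "openin (Euclidean_space d) (shadow k)"
proof -
  have "open {x. F (insert_coord k t x) < R}" for t
    by (intro open_Collect_less continuous_on_compose2[OF continuous_F] continuous_on_insert_coord
        continuous_on_const continuous_on_id) simp_all
  then have "open (\<Union>t. {x. F (insert_coord k t x) < R})"
    by blast
  moreover have "shadow k = {x. \<forall>i\<ge>d. x i = 0} \<inter> (\<Union>t. {x. F (insert_coord k t x) < R})"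
    by (auto simp: shadow_def)
  ultimately show ?thesis
    unfolding Euclidean_space_eq openin_open by blast
qed

text \<open>At \<open>x\<close> the height is enclosed between a point inside the level set and a point outside it with the correct slope.
  Both are open conditions, so they enclose the height at all nearby points too.\<close>

lemma continuous_on_height:
  assumes k: "k \<le> d" and e: "e = 1 \<or> e = -1"
  shows "continuous_on (shadow k) (height k e)"
  unfolding continuous_on_def
proof (intro ballI tendstoI)
  fix x and \<epsilon> :: real assume x: "x \<in> shadow k" and "\<epsilon> > 0"
  define s where "s = height k e x"
  have s: "F (insert_coord k s x) = R" "0 < e * D k (insert_coord k s x)"
    using graph_properties[OF k e x] by (simp_all add: s_def)
  obtain \<delta> where \<delta>: "0 < \<delta>" "\<delta> < \<epsilon>" "F (insert_coord k (s - e * \<delta>) x) < R"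
    using points_below_height[OF k e s \<open>\<epsilon> > 0\<close>] .
  have ee: "e * e = 1" using e by auto
  have sq: "(e * \<epsilon>)\<^sup>2 > 0" using e \<open>\<epsilon> > 0\<close> by auto
  have above: "R < F (insert_coord k (s + e * \<epsilon>) x)"
  proof -
    have "0 < e * D k (insert_coord k s x) * \<epsilon>"
      using s \<open>\<epsilon> > 0\<close> by simp
    then show ?thesis
      using line_convexity[OF k, of s x "s + e * \<epsilon>"] s(1) sq by (simp add: algebra_simps)
  qed
  have "0 < e * D k (insert_coord k (s + e * \<epsilon>) x) * \<epsilon>"
    using line_convexity[OF k, of "s + e * \<epsilon>" x s] s(1) above sq by (simp add: algebra_simps)
  then have slope: "0 < e * D k (insert_coord k (s + e * \<epsilon>) x)"
    using \<open>\<epsilon> > 0\<close> by (simp add: zero_less_mult_iff)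
  have F: "((\<lambda>y. F (insert_coord k t y)) \<longlongrightarrow> F (insert_coord k t x)) (at x within shadow k)"
    and D: "((\<lambda>y. e * D k (insert_coord k t y)) \<longlongrightarrow> e * D k (insert_coord k t x)) (at x within shadow k)" for t
  proof -
    have "continuous_on (shadow k) (\<lambda>y. F (insert_coord k t y))"
      "continuous_on (shadow k) (\<lambda>y. e * D k (insert_coord k t y))"
      by (intro continuous_intros continuous_on_compose2[OF continuous_F]
          continuous_on_compose2[OF continuous_D[OF k]]; simp)+
    then show "((\<lambda>y. F (insert_coord k t y)) \<longlongrightarrow> F (insert_coord k t x)) (at x within shadow k)"
      "((\<lambda>y. e * D k (insert_coord k t y)) \<longlongrightarrow> e * D k (insert_coord k t x)) (at x within shadow k)"
      using x by (auto simp: continuous_on_def)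
  qed
  have "\<forall>\<^sub>F y in at x within shadow k. y \<in> shadow k"
    by (simp add: eventually_at_filter)
  with order_tendstoD(2)[OF F \<delta>(3)] order_tendstoD(1)[OF F above] order_tendstoD(1)[OF D slope]
  show "\<forall>\<^sub>F y in at x within shadow k. dist (height k e y) (height k e x) < \<epsilon>"
  proof eventually_elim
    case (elim y)
    define t where "t = height k e y"
    have t: "F (insert_coord k t y) = R" "0 < e * D k (insert_coord k t y)"
      using graph_properties[OF k e elim(4)] by (simp_all add: t_def)
    have "0 < e * (t - (s - e * \<delta>))"
      using inside_below_height[OF k e t, of "s - e * \<delta>"] elim(1) t(1) by fastforce
    moreover have "0 < e * (s + e * \<epsilon> - t)"
    proof -
      have "D k (insert_coord k (s + e * \<epsilon>) y) * (t - (s + e * \<epsilon>)) < 0"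
        using line_convexity[OF k, of "s + e * \<epsilon>" y t] t(1) elim(2)
          zero_le_power2[of "t - (s + e * \<epsilon>)"] by linarith
      then show ?thesis
        using elim(3) e by (auto simp: mult_less_0_iff)
    qed
    ultimately have "\<bar>t - s\<bar> < \<epsilon>"
      using e \<delta> by (auto simp: algebra_simps)
    then show ?case
      by (simp add: s_def t_def dist_real_def)
  qed
qed

lemma continuous_on_graph:
  assumes "k \<le> d" "e = 1 \<or> e = -1"
  shows "continuous_on (shadow k) (graph k e)"
  by (intro continuous_on_insert_coord continuous_on_height assms continuous_on_id)

text \<open>The implicit function theorem by a squeeze. Let \<open>p\<close> and \<open>q\<close> be the points of the sheet over \<open>x\<close> and over \<open>x\<close> with
  its \<open>i\<close>-th coordinate moved by \<open>h\<close>. Since \<open>F p = F q\<close>, the tangent inequality at \<open>p\<close> bounds the difference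
  quotient on one side by the expected value \<open>a p\<close>, and the tangent inequality at \<open>q\<close> bounds it on the
  other side by \<open>a q\<close>, which tends to \<open>a p\<close>.\<close>

lemma height_derivative:
  assumes k: "k \<le> d" and e: "e = 1 \<or> e = -1" and x: "x \<in> shadow k" and i: "i < d"
  shows "((\<lambda>u. height k e (x(i := u))) has_real_derivative
    - D (skip k i) (graph k e x) / D k (graph k e x)) (at (x i))"
proof -
  define l where "l = skip k i"
  define q where "q u = graph k e (x(i := u))" for u
  define p where "p = graph k e x"
  define a where "a y = - D l y / D k y" for y
  define r where "r u = (height k e (x(i := u)) - height k e x) / (u - x i)" for u
  have kl: "l \<le> d" "k \<noteq> l"
    using skip_le[OF i] not_sym[OF skip_neq] by (simp_all add: l_def)
  have p: "F p = R" "0 < e * D k p"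
    using graph_properties[OF k e x] by (simp_all add: p_def)
  have ev: "\<forall>\<^sub>F u in at (x i). x(i := u) \<in> shadow k"
    using fun_upd_eventually_in_open[OF openin_shadow x i] by (simp add: eventually_at_filter eventually_mono)
  have "(fun_upd x i \<longlongrightarrow> x) (at (x i))"
    using continuous_on_fun_upd[of x i]
    by (metis UNIV_I continuous_on_def fun_upd_triv)
  then have "(q \<longlongrightarrow> p) (at (x i))"
    unfolding q_def p_def
    by (rule continuous_on_tendsto_compose[OF continuous_on_graph[OF k e] _ x ev])
  then have lim: "((\<lambda>u. D j (q u)) \<longlongrightarrow> D j p) (at (x i))" if "j \<le> d" for j
    using continuous_on_tendsto_compose[OF continuous_D[OF that]] by simp
  have "((\<lambda>u. a (q u)) \<longlongrightarrow> a p) (at (x i))"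
    unfolding a_def using p(2) by (intro tendsto_intros lim k kl) auto
  then have null: "((\<lambda>u. a (q u) - a p) \<longlongrightarrow> 0) (at (x i))"
    by (rule LIM_zero)
  have squeeze: "\<forall>\<^sub>F u in at (x i). norm (r u - a p) \<le> norm (a (q u) - a p)"
    using ev eventually_neq_at_within[of "x i" "x i" UNIV]
  proof eventually_elim
    case (elim u)
    define h where "h = u - x i"
    have "h \<noteq> 0" using elim by (simp add: h_def)
    have Q: "F (q u) = R" "0 < e * D k (q u)"
      using graph_properties[OF k e elim(1)] by (simp_all add: q_def)
    have r: "q u k - p k = r u * h" "q u l - p l = h"
      using \<open>h \<noteq> 0\<close> by (simp_all add: q_def p_def l_def r_def h_def)
    have same: "q u j = p j" if "j \<noteq> k" "j \<noteq> l" for j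
      using that by (auto simp: q_def p_def insert_coord_def l_def skip_def split: if_splits)
    have diff: "p k - q u k = - (r u * h)" "p l - q u l = - h"
      using r by linarith+
    have "F p + D k p * (r u * h) + D l p * h \<le> F (q u)"
      using plane_convexity[of k l "q u" p] k kl same unfolding r by blast
    then have 1: "h * (D k p * r u + D l p) \<le> 0"
      using p(1) Q(1) by (simp add: algebra_simps)
    have "F (q u) + D k (q u) * (- (r u * h)) + D l (q u) * (- h) \<le> F p"
      using plane_convexity[of k l p "q u"] k kl same[symmetric] unfolding diff by blast
    then have 2: "0 \<le> h * (D k (q u) * r u + D l (q u))"
      using p(1) Q(1) by (simp add: algebra_simps)
    have split: "D k y * r u + D l y = D k y * (r u - a y)" if "0 < e * D k y" for y
      using that by (auto simp: a_def field_simps)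
    have eq: "(e * b) * ((e * h) * c) = h * (b * c)" for b c
      using e by (auto simp: mult.left_commute)
    have 1: "(e * D k p) * ((e * h) * (r u - a p)) \<le> 0"
      and 2: "0 \<le> (e * D k (q u)) * ((e * h) * (r u - a (q u)))"
      using 1 2 unfolding split[OF p(2)] split[OF Q(2)] eq by blast+
    have bounds: "(e * h) * (r u - a p) \<le> 0" "0 \<le> (e * h) * (r u - a (q u))"
      using 1 2 mult_le_cancel_left_pos[OF p(2), of _ 0] mult_le_cancel_left_pos[OF Q(2), of 0]
      unfolding mult_zero_right by blast+
    (* either way r u lies between a p and a (q u) *)
    consider "0 < e * h" | "e * h < 0"
      using \<open>h \<noteq> 0\<close> e by fastforce
    then show ?case
    proof cases
      case 1
      then have "a (q u) \<le> r u" "r u \<le> a p"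
        using bounds unfolding mult_le_0_iff[of "e * h"] zero_le_mult_iff[of "e * h"] by auto
      then show ?thesis by simp
    next
      case 2
      then have "r u \<le> a (q u)" "a p \<le> r u"
        using bounds unfolding mult_le_0_iff[of "e * h"] zero_le_mult_iff[of "e * h"] by auto
      then show ?thesis by simp
    qed
  qed
  have "((\<lambda>u. r u - a p) \<longlongrightarrow> 0) (at (x i))"
    by (rule Lim_null_comparison[OF squeeze tendsto_norm_zero[OF null]])
  then have "(r \<longlongrightarrow> a p) (at (x i))"
    by (rule LIM_zero_cancel)
  then show ?thesis
    by (simp add: has_field_derivative_iff r_def[abs_def] a_def p_def l_def)
qed

text \<open>By the tangent inequality the gradient at \<open>p\<close> pairs negatively with \<open>q - p\<close>, for every interior point \<open>q\<close>. The choice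
  of \<open>q\<close> decides which partial derivatives are candidates: coordinates shared by \<open>p\<close> and \<open>q\<close> do not occur.\<close>

lemma nonzero_gradient:
  assumes "p \<in> hypersurface" "F q < R"
  shows "\<exists>l\<le>d. D l p \<noteq> 0 \<and> q l \<noteq> p l"
proof (rule ccontr)
  assume "\<not> ?thesis"
  then have "(\<Sum>i\<le>d. D i p * (q i - p i)) = 0"
    by (intro sum.neutral) auto
  moreover have "0 \<le> (\<Sum>i\<le>d. (q i - p i)\<^sup>2)"
    by (intro sum_nonneg) auto
  ultimately show False
    using strong_convexity[of p q] assms by (simp add: hypersurface_def)
qed

lemma graph_coordinate_derivative:
  assumes "k \<le> d" "e = 1 \<or> e = -1" "x \<in> shadow k" "i < d"
  shows "((\<lambda>u. graph k e (x(i := u)) j) has_real_derivative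
    (if j = k then - D (skip k i) (graph k e x) / D k (graph k e x)
     else if j = skip k i then 1 else 0)) (at (x i))"
proof (cases "j = k")
  case True
  then show ?thesis
    using height_derivative[OF assms] by simp
next
  case False
  have "graph k e (x(i := u)) j = (if j = skip k i then u else graph k e x j)" for u
    unfolding insert_coord_upd using False by (simp add: insert_coord_def)
  then show ?thesis
    using False by simp
qed

text \<open>The generators are the coordinates of the parametrisation \<open>graph\<close>. Their partial derivatives are constants or
  quotients of gradient entries evaluated along the parametrisation, hence elementary in the same
  generators. Transition maps and coordinate functions have this form in every chart.\<close>

lemma smooth_on_graph_coordinate:
  assumes k: "k \<le> d" and e: "e = 1 \<or> e = -1"
    and "S \<subseteq> shadow k" "openin (Euclidean_space d) S" "\<And>x. x \<in> S \<Longrightarrow> f x = graph k e x j"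
  shows "smooth_on d S f"
proof (rule elementary_smooth_on)
  show "continuous_on (shadow k) g" if "g \<in> range (\<lambda>j x. graph k e x j)" for g
    using that continuous_on_product_then_coordinatewise[OF continuous_on_graph[OF k e]] by auto
  show "(\<lambda>x. graph k e x j) \<in> elementary (shadow k) (range (\<lambda>j x. graph k e x j))"
    by (rule elementary.gen) simp
  show "\<exists>g'\<in>elementary (shadow k) (range (\<lambda>j x. graph k e x j)).
      \<forall>x\<in>shadow k. ((\<lambda>t. g (x(i := t))) has_real_derivative g' x) (at (x i))"
    if "g \<in> range (\<lambda>j x. graph k e x j)" "i < d" for g i
  proof -
    obtain l where g: "g = (\<lambda>x. graph k e x l)"
      using \<open>g \<in> _\<close> by blast
    have D: "(\<lambda>x. D m (graph k e x)) \<in> elementary (shadow k) (range (\<lambda>j x. graph k e x j))"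
      if "m \<le> d" for m
    proof (rule elementary_compose[OF elementary_D[OF that]])
      fix h :: "(nat \<Rightarrow> real) \<Rightarrow> real" assume "h \<in> range (\<lambda>j p. p j)"
      then show "(\<lambda>x. h (graph k e x)) \<in> elementary (shadow k) (range (\<lambda>j x. graph k e x j))"
        by (intro elementary.gen) auto
    qed simp
    have nonzero: "D k (graph k e x) \<noteq> 0" if "x \<in> shadow k" for x
      using graph_properties(2)[OF k e that] by auto
    define g' where "g' x = (if l = k
      then (-1) * D (skip k i) (graph k e x) * inverse (D k (graph k e x))
      else if l = skip k i then 1 else 0)" for x
    have "g' \<in> elementary (shadow k) (range (\<lambda>j x. graph k e x j))"
    proof (cases "l = k")
      case True
      have "(\<lambda>x. (-1) * D (skip k i) (graph k e x) * inverse (D k (graph k e x)))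
          \<in> elementary (shadow k) (range (\<lambda>j x. graph k e x j))"
        by (intro elementary.mult[OF elementary.mult[OF elementary.const D] elementary.inverse[OF D]]
            nonzero k skip_le \<open>i < d\<close>)
      then show ?thesis
        using True by (simp add: g'_def[abs_def])
    next
      case False
      then have "g' = (\<lambda>x. if l = skip k i then 1 else 0)"
        by (simp add: g'_def[abs_def])
      then show ?thesis
        by (simp only: elementary.const)
    qed
    moreover have "((\<lambda>t. g (x(i := t))) has_real_derivative g' x) (at (x i))" if "x \<in> shadow k" for x
    proof -
      have "g' x = (if l = k then - D (skip k i) (graph k e x) / D k (graph k e x)
          else if l = skip k i then 1 else 0)"
        by (simp add: g'_def divide_inverse)
      then show ?thesis
        using graph_coordinate_derivative[OF k e that \<open>i < d\<close>, of l] by (simp only: g)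
    qed
    ultimately show ?thesis by blast
  qed
qed (use assms in auto)

definition atlas :: "(nat \<Rightarrow> real) chart set" where
  "atlas = {(chart_domain k e, drop_coord k) |k e. k \<le> d \<and> (e = 1 \<or> e = -1)}"

lemma openin_chart_domain:
  assumes "k \<le> d"
  shows "openin (top_of_set hypersurface) (chart_domain k e)"
proof -
  have "open {p. 0 < e * D k p}"
    by (intro open_Collect_less continuous_intros continuous_D assms)
  moreover have "chart_domain k e = hypersurface \<inter> {p. 0 < e * D k p}"
    by (auto simp: chart_domain_def)
  ultimately show ?thesis
    unfolding openin_open by blast
qed

lemma subtopology_shadow: "subtopology (Euclidean_space d) (shadow k) = top_of_set (shadow k)"
proof -
  have "{x. \<forall>i\<ge>d. x i = 0} \<inter> shadow k = shadow k"
    by (auto simp: shadow_def)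
  then show ?thesis
    by (simp add: Euclidean_space_eq subtopology_subtopology)
qed

lemma is_chart_drop_coord:
  assumes k: "k \<le> d" and e: "e = 1 \<or> e = -1"
  shows "is_chart (top_of_set hypersurface) d (chart_domain k e, drop_coord k)"
proof -
  have sub: "subtopology (top_of_set hypersurface) (chart_domain k e) = top_of_set (chart_domain k e)"
    using openin_subset[OF openin_chart_domain[OF k, of e]]
    by (simp add: subtopology_subtopology Int_absorb1)
  have "homeomorphic_maps (top_of_set (chart_domain k e)) (top_of_set (shadow k))
      (drop_coord k) (graph k e)"
    using image_drop_coord[OF k e] graph_in_chart_domain[OF k e] drop_coord_chart_domain[OF k e]
    by (auto simp: homeomorphic_maps_def continuous_on_drop_coord continuous_on_graph[OF k e])
  then have "homeomorphic_map (top_of_set (chart_domain k e)) (top_of_set (shadow k)) (drop_coord k)"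
    unfolding homeomorphic_map_maps by blast
  then show ?thesis
    unfolding is_chart_def prod.case image_drop_coord[OF k e] subtopology_shadow sub
    using openin_chart_domain[OF k] openin_shadow by simp
qed

lemma smooth_transition_drop_coord:
  assumes k: "k \<le> d" and e: "e = 1 \<or> e = -1" and k': "k' \<le> d"
  shows "smooth_transition d (chart_domain k e, drop_coord k) (chart_domain k' e', drop_coord k')"
proof -
  let ?S = "drop_coord k ` (chart_domain k e \<inter> chart_domain k' e')"
  have "?S = shadow k \<inter> (\<lambda>x. e' * D k' (graph k e x)) -` {0<..}"
  proof (intro equalityI subsetI)
    fix x assume "x \<in> ?S"
    then show "x \<in> shadow k \<inter> (\<lambda>x. e' * D k' (graph k e x)) -` {0<..}"
      using drop_coord_chart_domain[OF k e] by (auto simp: chart_domain_def)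
  next
    fix x assume x: "x \<in> shadow k \<inter> (\<lambda>x. e' * D k' (graph k e x)) -` {0<..}"
    then have "graph k e x \<in> chart_domain k e \<inter> chart_domain k' e'"
      using graph_in_chart_domain[OF k e] by (auto simp: chart_domain_def)
    then show "x \<in> ?S"
      by (intro image_eqI[of x _ "graph k e x"]) simp_all
  qed
  moreover have "continuous_on (shadow k) (\<lambda>x. e' * D k' (graph k e x))"
    by (intro continuous_intros continuous_on_compose2[OF continuous_D[OF k'] continuous_on_graph[OF k e]]) simp
  then have "openin (top_of_set (shadow k)) (shadow k \<inter> (\<lambda>x. e' * D k' (graph k e x)) -` {0<..})"
    by (rule continuous_openin_preimage_gen) simp
  ultimately have S: "?S \<subseteq> shadow k" "openin (Euclidean_space d) ?S"
    using openin_open_subtopology[OF openin_shadow] by (auto simp: subtopology_shadow)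
  have "smooth_on d ?S (\<lambda>x. drop_coord k' (inv_into (chart_domain k e) (drop_coord k) x) i)" for i
  proof (rule smooth_on_graph_coordinate[OF k e S])
    fix x assume "x \<in> ?S"
    then show "drop_coord k' (inv_into (chart_domain k e) (drop_coord k) x) i =
        graph k e x (skip k' i)"
      using S(1) inv_drop_coord[OF k e] by (auto simp: drop_coord_def skip_def)
  qed
  then show ?thesis
    by (simp add: smooth_transition_def)
qed

theorem smooth_manifold_hypersurface: "smooth_manifold (top_of_set hypersurface) d atlas"
proof -
  have "hypersurface \<subseteq> (\<Union>(U, \<phi>)\<in>atlas. U)"
  proof
    fix p assume p: "p \<in> hypersurface"
    then obtain k where k: "k \<le> d" "D k p \<noteq> 0"
      using nonzero_gradient inner_point by blast
    define e :: real where "e = (if 0 < D k p then 1 else - 1)"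
    have "p \<in> chart_domain k e"
      using p k(2) by (auto simp: chart_domain_def e_def)
    moreover have "(chart_domain k e, drop_coord k) \<in> atlas"
      using k(1) unfolding atlas_def e_def by fastforce
    ultimately show "p \<in> (\<Union>(U, \<phi>)\<in>atlas. U)" by blast
  qed
  moreover have "(\<Union>(U, \<phi>)\<in>atlas. U) \<subseteq> hypersurface"
    by (auto simp: atlas_def chart_domain_def)
  ultimately have cover: "(\<Union>(U, \<phi>)\<in>atlas. U) = topspace (top_of_set hypersurface)"
    by simp
  have "smooth_transition d c c'" if "c \<in> atlas" "c' \<in> atlas" for c c'
    using that smooth_transition_drop_coord unfolding atlas_def by blast
  moreover have "is_chart (top_of_set hypersurface) d c" if "c \<in> atlas" for c
    using that is_chart_drop_coord unfolding atlas_def by blast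
  ultimately show ?thesis
    unfolding smooth_manifold_def using cover
    by (simp add: Hausdorff_space_subtopology second_countable_subtopology second_countable_euclidean)
qed

theorem compact_space_hypersurface: "compact_space (top_of_set hypersurface)"
proof -
  have "hypersurface = (\<Inter>i\<in>{d<..}. {p. p i = 0}) \<inter> {p. F p = R}"
    by (auto simp: hypersurface_def)
  moreover have "closed ((\<Inter>i\<in>{d<..}. {p. p i = 0}) \<inter> {p. F p = R})"
    by (intro closed_Int closed_INT ballI closed_Collect_eq continuous_F continuous_on_const) simp
  ultimately have closed: "closed hypersurface" by simp
  have "\<bar>p i\<bar> \<le> \<bar>R\<bar> + 1" if "p \<in> hypersurface" for p i
  proof (cases "i \<le> d")
    case True
    then have "(p i)\<^sup>2 \<le> (\<Sum>i\<le>d. (p i)\<^sup>2)"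
      by (intro member_le_sum) auto
    then have "(p i)\<^sup>2 \<le> R"
      using coercive[of p] that by (simp add: hypersurface_def)
    moreover have "(\<bar>R\<bar> + 1)\<^sup>2 = R\<^sup>2 + 2 * \<bar>R\<bar> + 1"
      by (simp add: power2_sum)
    ultimately have "\<bar>p i\<bar>\<^sup>2 \<le> (\<bar>R\<bar> + 1)\<^sup>2"
      using zero_le_power2[of R] unfolding power2_abs by linarith
    then show ?thesis
      by (rule power2_le_imp_le) simp
  next
    case False
    then show ?thesis
      using that by (simp add: hypersurface_def)
  qed
  then have "hypersurface = hypersurface \<inter> {p. \<forall>i. \<bar>p i\<bar> \<le> \<bar>R\<bar> + 1}"
    by auto
  then have "compact hypersurface"
    using closed_Int_compact[OF closed compact_cube] by metis
  then show ?thesis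
    by (simp add: compact_space_subtopology)
qed

theorem smooth_function_coordinate: "smooth_function d atlas (\<lambda>p. p j)"
proof -
  have "smooth_on d (drop_coord k ` chart_domain k e)
      ((\<lambda>p. p j) \<circ> inv_into (chart_domain k e) (drop_coord k))"
    if "k \<le> d" "e = 1 \<or> e = -1" for k e
    unfolding image_drop_coord[OF that]
    by (rule smooth_on_graph_coordinate[OF that subset_refl openin_shadow, of _ j])
      (simp add: inv_drop_coord[OF that])
  then show ?thesis
    unfolding smooth_function_def atlas_def by auto
qed

lemma differential_coeff_coordinate:
  assumes k: "k \<le> d" and e: "e = 1 \<or> e = -1" and p: "p \<in> chart_domain k e" and i: "i < d"
  shows "differential_coeff (chart_domain k e, drop_coord k) (\<lambda>p. p j) p i =
    (if j = k then - D (skip k i) p / D k p else if j = skip k i then 1 else 0)"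
proof -
  let ?x = "drop_coord k p" and ?inv = "inv_into (chart_domain k e) (drop_coord k)"
  note x = drop_coord_chart_domain[OF k e p]
  have "\<forall>\<^sub>F t in nhds (?x i). ?inv (?x(i := t)) j = graph k e (?x(i := t)) j"
    using fun_upd_eventually_in_open[OF openin_shadow x(1) i]
    by eventually_elim (simp add: inv_drop_coord[OF k e])
  then have "((\<lambda>t. ?inv (?x(i := t)) j) has_real_derivative
      (if j = k then - D (skip k i) p / D k p else if j = skip k i then 1 else 0)) (at (?x i))"
    using graph_coordinate_derivative[OF k e x(1) i, of j] unfolding x(2)
    by (subst DERIV_cong_ev[OF refl _ refl]) simp_all
  then show ?thesis
    by (simp add: differential_coeff_def partial_deriv_def DERIV_imp_deriv)
qed

text \<open>Independence of the \<open>dp\<^sub>j\<close>, \<open>j \<in> J\<close>, on the tangent space of the level set means that \<open>dF\<close> is not in their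
  span, and a non-zero entry of the gradient outside \<open>J\<close> witnesses this. In the chart that drops
  coordinate \<open>k\<close>, only \<open>dp\<^sub>k\<close> has an entry in the direction \<open>l\<close>, which settles \<open>a k\<close>; the remaining differentials
  are distinct basis covectors.\<close>

theorem coordinate_differentials_independent:
  assumes J: "finite J" "J \<subseteq> {..d}" and l: "l \<le> d" "l \<notin> J" "D l p \<noteq> 0"
  shows "differentials_independent_at d atlas (\<lambda>j p. p j) J p"
  unfolding differentials_independent_at_def
proof (intro ballI impI allI)
  fix c a j
  assume "c \<in> atlas" "p \<in> fst c" and j: "j \<in> J"
    and zero: "\<forall>i<d. (\<Sum>j\<in>J. a j * differential_coeff c (\<lambda>p. p j) p i) = 0"
  obtain k e where k: "k \<le> d" and e: "e = 1 \<or> e = -1"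
    and c: "c = (chart_domain k e, drop_coord k)"
    using \<open>c \<in> atlas\<close> unfolding atlas_def by blast
  have p: "p \<in> chart_domain k e"
    using \<open>p \<in> fst c\<close> by (simp add: c)
  have zero: "(\<Sum>j\<in>J. a j * (if j = k then - D (skip k i) p / D k p
      else if j = skip k i then 1 else 0)) = 0" if "i < d" for i
    using zero[rule_format, OF that] unfolding c differential_coeff_coordinate[OF k e p that] .
  have ak: "a k = 0" if "k \<in> J"
  proof -
    have "l \<noteq> k" using that l by auto
    then obtain i where i: "i < d" "l = skip k i"
      using skip_surj l(1) k by blast
    have collapse: "(\<Sum>j\<in>J. a j * (if j = k then - D l p / D k p else if j = l then 1 else 0)) =
        (\<Sum>j\<in>J. if j = k then a k * (- D l p / D k p) else 0)"
      using l(2) by (intro sum.cong) auto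
    then have "a k * (- D l p / D k p) = 0"
      using zero[OF i(1)] that J(1) unfolding i(2)[symmetric] collapse by simp
    then show ?thesis
      using l(3) p by (auto simp: chart_domain_def)
  qed
  show "a j = 0"
  proof (cases "j = k")
    case True
    then show ?thesis using ak j by simp
  next
    case False
    then obtain i where i: "i < d" "j = skip k i"
      using skip_surj j J(2) k by blast
    have collapse: "(\<Sum>m\<in>J. a m * (if m = k then - D j p / D k p else if m = j then 1 else 0)) =
        (\<Sum>m\<in>J. if m = j then a j else 0)"
      using ak False by (intro sum.cong) auto
    then show ?thesis
      using zero[OF i(1)] j J(1) unfolding i(2)[symmetric] collapse by simp
  qed
qed

lemma convex_along_segment:
  assumes "0 \<le> t" "t \<le> 1"
  shows "F (\<lambda>i. (1 - t) * p i + t * q i) \<le> (1 - t) * F p + t * F q"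
proof -
  define m where "m = (\<lambda>i. (1 - t) * p i + t * q i)"
  define S where "S = (\<Sum>i\<le>d. D i m * (q i - p i))"
  have tangent: "F m + (\<Sum>i\<le>d. D i m * (r i - m i)) \<le> F r" for r
    using strong_convexity[of m r] sum_nonneg[of "{..d}" "\<lambda>i. (r i - m i)\<^sup>2"] by simp
  have "(\<Sum>i\<le>d. D i m * (p i - m i)) = (- t) * S"
    unfolding S_def sum_distrib_left by (intro sum.cong) (auto simp: m_def algebra_simps)
  then have p: "F m + (- t) * S \<le> F p"
    using tangent[of p] by simp
  have "(\<Sum>i\<le>d. D i m * (q i - m i)) = (1 - t) * S"
    unfolding S_def sum_distrib_left by (intro sum.cong) (auto simp: m_def algebra_simps)
  then have q: "F m + (1 - t) * S \<le> F q"
    using tangent[of q] by simp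
  have "(1 - t) * (F m + (- t) * S) + t * (F m + (1 - t) * S) \<le> (1 - t) * F p + t * F q"
    by (intro add_mono mult_left_mono p q) (use assms in auto)
  moreover have "(1 - t) * (F m + (- t) * S) + t * (F m + (1 - t) * S) = F m"
    by (simp add: algebra_simps)
  ultimately show ?thesis
    by (simp add: m_def)
qed

end

section \<open>The level set modelled on a simplicial complex\<close>

locale labelled_complex =
  fixes n :: nat and L :: "nat set set"
  assumes complex: "abstract_simplicial_complex {1..n} L"
begin

definition nonfaces :: "nat set set" where
  "nonfaces = Pow {1..n} - L"

text \<open>A single barrier at its value \<open>1\<close> must already exceed the level \<open>n + 1\<close>.\<close>

definition barrier_weight :: real where
  "barrier_weight = real n + 2"

text \<open>Chosen so that all barriers together contribute at most \<open>rate * exp (- rate) < 1\<close> as soon as every exponent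
  is at most \<open>- rate\<close>.\<close>

definition rate :: real where
  "rate = barrier_weight * real (card nonfaces)"

definition barrier :: "nat set \<Rightarrow> (nat \<Rightarrow> real) \<Rightarrow> real" where
  "barrier A p = exp (- rate * (\<Sum>j\<in>A. p j))"

definition potential :: "(nat \<Rightarrow> real) \<Rightarrow> real" where
  "potential p = (\<Sum>i\<le>Suc n. (p i)\<^sup>2) + barrier_weight * (\<Sum>A\<in>nonfaces. barrier A p)"

definition gradient :: "nat \<Rightarrow> (nat \<Rightarrow> real) \<Rightarrow> real" where
  "gradient i p = 2 * p i + (- (barrier_weight * rate)) * (\<Sum>A | A \<in> nonfaces \<and> i \<in> A. barrier A p)"

text \<open>For a simplex \<open>J\<close>, a point strictly inside the level set whose coordinates with index in \<open>J\<close> vanish. It also vanishes at the end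
  indices \<open>0\<close> and \<open>n + 1\<close>, which carry no vertex.\<close>

definition corner_point :: "nat set \<Rightarrow> nat \<Rightarrow> real" where
  "corner_point J i = (if i \<in> {1..n} - J then 1 else 0)"

lemma finite_nonfaces: "finite nonfaces"
  by (simp add: nonfaces_def)

lemma nonface_subset: "A \<in> nonfaces \<Longrightarrow> A \<subseteq> {1..n}"
  by (simp add: nonfaces_def)

lemma barrier_weight_pos: "0 < barrier_weight"
  by (simp add: barrier_weight_def add_nonneg_pos)

lemma barrier_pos: "0 < barrier A p"
  by (simp add: barrier_def)

lemma sum_barrier_nonneg: "0 \<le> (\<Sum>A\<in>nonfaces. barrier A p)"
  by (intro sum_nonneg less_imp_le[OF barrier_pos])

text \<open>The inequality \<open>1 + s \<le> exp s\<close>, scaled by the value of the barrier at \<open>p\<close>.\<close>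

lemma barrier_tangent:
  "barrier A p + (- rate) * (\<Sum>i\<in>A. barrier A p * (q i - p i)) \<le> barrier A q"
proof -
  define s where "s = - rate * (\<Sum>i\<in>A. q i - p i)"
  have "barrier A q = barrier A p * exp s"
    unfolding barrier_def s_def exp_add[symmetric] by (simp add: sum_subtractf algebra_simps)
  moreover have "barrier A p * (1 + s) \<le> barrier A p * exp s"
    using barrier_pos[of A p] by (intro mult_left_mono) auto
  moreover have "barrier A p * (1 + s) = barrier A p + (- rate) * (\<Sum>i\<in>A. barrier A p * (q i - p i))"
    unfolding s_def sum_distrib_left[symmetric] by (simp add: algebra_simps)
  ultimately show ?thesis by simp
qed

lemma gradient_pairing:
  "(\<Sum>i\<le>Suc n. gradient i p * h i) = (\<Sum>i\<le>Suc n. 2 * p i * h i)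
    + barrier_weight * (\<Sum>A\<in>nonfaces. (- rate) * (\<Sum>i\<in>A. barrier A p * h i))"
proof -
  have "(\<Sum>i\<le>Suc n. (\<Sum>A | A \<in> nonfaces \<and> i \<in> A. barrier A p) * h i)
      = (\<Sum>i\<le>Suc n. \<Sum>A | A \<in> nonfaces \<and> i \<in> A. barrier A p * h i)"
    by (simp only: sum_distrib_right)
  also have "\<dots> = (\<Sum>A\<in>nonfaces. \<Sum>i | i \<in> {..Suc n} \<and> i \<in> A. barrier A p * h i)"
    by (rule sum.swap_restrict) (simp_all add: finite_nonfaces)
  also have "\<dots> = (\<Sum>A\<in>nonfaces. \<Sum>i\<in>A. barrier A p * h i)"
  proof (rule sum.cong[OF refl])
    fix A assume "A \<in> nonfaces"
    then have "{i. i \<in> {..Suc n} \<and> i \<in> A} = A"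
      using nonface_subset[of A] by fastforce
    then show "(\<Sum>i | i \<in> {..Suc n} \<and> i \<in> A. barrier A p * h i) = (\<Sum>i\<in>A. barrier A p * h i)"
      by simp
  qed
  finally have swap: "(\<Sum>i\<le>Suc n. (\<Sum>A | A \<in> nonfaces \<and> i \<in> A. barrier A p) * h i)
      = (\<Sum>A\<in>nonfaces. \<Sum>i\<in>A. barrier A p * h i)" .
  define S where "S i = (\<Sum>A | A \<in> nonfaces \<and> i \<in> A. barrier A p)" for i
  have "gradient i p * h i = 2 * p i * h i + (- (barrier_weight * rate)) * (S i * h i)" for i
    by (simp only: gradient_def S_def distrib_right mult.assoc)
  then have "(\<Sum>i\<le>Suc n. gradient i p * h i) = (\<Sum>i\<le>Suc n. 2 * p i * h i)
      + (- (barrier_weight * rate)) * (\<Sum>i\<le>Suc n. S i * h i)"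
    by (simp only: sum.distrib sum_distrib_left)
  then show ?thesis
    unfolding S_def swap sum_distrib_left[symmetric]
    by (simp only: mult.assoc mult_minus_left mult_minus_right)
qed

lemma potential_strongly_convex:
  "potential p + (\<Sum>i\<le>Suc n. gradient i p * (q i - p i)) + (\<Sum>i\<le>Suc n. (q i - p i)\<^sup>2)
    \<le> potential q"
proof -
  have "(\<Sum>i\<le>Suc n. (q i)\<^sup>2) = (\<Sum>i\<le>Suc n. (p i)\<^sup>2 + 2 * p i * (q i - p i) + (q i - p i)\<^sup>2)"
    by (intro sum.cong) (auto simp: power2_eq_square algebra_simps)
  then have squares: "(\<Sum>i\<le>Suc n. (q i)\<^sup>2) = (\<Sum>i\<le>Suc n. (p i)\<^sup>2)
      + (\<Sum>i\<le>Suc n. 2 * p i * (q i - p i)) + (\<Sum>i\<le>Suc n. (q i - p i)\<^sup>2)"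
    by (simp only: sum.distrib)
  have "(\<Sum>A\<in>nonfaces. barrier A p + (- rate) * (\<Sum>i\<in>A. barrier A p * (q i - p i)))
      \<le> (\<Sum>A\<in>nonfaces. barrier A q)"
    by (intro sum_mono barrier_tangent)
  then have "barrier_weight * ((\<Sum>A\<in>nonfaces. barrier A p)
      + (\<Sum>A\<in>nonfaces. (- rate) * (\<Sum>i\<in>A. barrier A p * (q i - p i))))
      \<le> barrier_weight * (\<Sum>A\<in>nonfaces. barrier A q)"
    using barrier_weight_pos by (simp only: sum.distrib mult_le_cancel_left_pos)
  then show ?thesis
    unfolding potential_def gradient_pairing squares distrib_left by linarith
qed

text \<open>Because the complex is closed under subsets, a non-simplex is not contained in the simplex \<open>J\<close>, so
  it has an element at which the corner point is \<open>1\<close>. The squares contribute at most \<open>n\<close>.\<close>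

lemma potential_corner_point:
  assumes "J \<in> L"
  shows "potential (corner_point J) < real n + 1"
proof -
  have "(\<Sum>i\<le>Suc n. (corner_point J i)\<^sup>2) = (\<Sum>i\<in>{1..n}. (corner_point J i)\<^sup>2)"
    by (intro sum.mono_neutral_right) (auto simp: corner_point_def)
  also have "\<dots> \<le> (\<Sum>i\<in>{1..n}. 1)"
    by (intro sum_mono) (auto simp: corner_point_def)
  finally have squares: "(\<Sum>i\<le>Suc n. (corner_point J i)\<^sup>2) \<le> real n"
    by simp
  have "barrier A (corner_point J) \<le> exp (- rate)" if A: "A \<in> nonfaces" for A
  proof -
    have "\<not> A \<subseteq> J"
      using A assms complex unfolding abstract_simplicial_complex_def nonfaces_def by blast
    then obtain j where j: "j \<in> A" "j \<notin> J" by blast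
    have "corner_point J j \<le> (\<Sum>j\<in>A. corner_point J j)"
      using j(1) finite_subset[OF nonface_subset[OF A]]
      by (intro member_le_sum) (auto simp: corner_point_def)
    moreover have "corner_point J j = 1"
      using j nonface_subset[OF A] by (auto simp: corner_point_def)
    moreover have "0 \<le> rate"
      using barrier_weight_pos by (simp add: rate_def)
    ultimately show ?thesis
      unfolding barrier_def using mult_left_mono[of 1 "\<Sum>j\<in>A. corner_point J j" rate] by simp
  qed
  then have "(\<Sum>A\<in>nonfaces. barrier A (corner_point J)) \<le> real (card nonfaces) * exp (- rate)"
    by (rule sum_bounded_above)
  then have "barrier_weight * (\<Sum>A\<in>nonfaces. barrier A (corner_point J))
      \<le> barrier_weight * (real (card nonfaces) * exp (- rate))"
    using barrier_weight_pos by (intro mult_left_mono) auto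
  also have "\<dots> = rate * exp (- rate)"
    by (simp add: rate_def)
  also have "\<dots> < 1"
  proof -
    have "rate < exp rate"
      using exp_ge_add_one_self[of rate] by linarith
    then show ?thesis
      by (simp add: exp_minus divide_inverse[symmetric])
  qed
  finally show ?thesis
    unfolding potential_def using squares by linarith
qed

lemma potential_on_nonface:
  assumes "A \<in> nonfaces" "\<And>j. j \<in> A \<Longrightarrow> p j = 0"
  shows "real n + 1 < potential p"
proof -
  have weight: "real n + 1 < barrier_weight"
    by (simp add: barrier_weight_def)
  have "barrier A p = 1"
    using assms(2) by (simp add: barrier_def)
  moreover have "barrier A p \<le> (\<Sum>A\<in>nonfaces. barrier A p)"
    by (intro member_le_sum assms(1) finite_nonfaces less_imp_le[OF barrier_pos])
  ultimately have "barrier_weight * 1 \<le> barrier_weight * (\<Sum>A\<in>nonfaces. barrier A p)"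
    using barrier_weight_pos by (intro mult_left_mono) auto
  moreover have "0 \<le> (\<Sum>i\<le>Suc n. (p i)\<^sup>2)"
    by (intro sum_nonneg) auto
  ultimately show ?thesis
    unfolding potential_def using weight by linarith
qed

lemma elementary_barrier: "barrier A \<in> elementary UNIV (range (\<lambda>j p. p j))"
proof -
  have "(\<lambda>p. exp (- rate * (\<Sum>j\<in>A. p j))) \<in> elementary UNIV (range (\<lambda>j p. p j))"
    by (intro elementary.exp elementary.mult[OF elementary.const] elementary_sum elementary.gen) auto
  then show ?thesis
    by (simp add: barrier_def[abs_def])
qed

lemma elementary_gradient: "gradient i \<in> elementary UNIV (range (\<lambda>j p. p j))"
proof -
  have "(\<lambda>p. 2 * p i + (- (barrier_weight * rate)) * (\<Sum>A | A \<in> nonfaces \<and> i \<in> A. barrier A p))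
      \<in> elementary UNIV (range (\<lambda>j p. p j))"
    by (rule elementary.add[OF elementary.mult[OF elementary.const elementary.gen]
          elementary.mult[OF elementary.const elementary_sum[OF elementary_barrier]]]) simp
  then show ?thesis
    by (simp add: gradient_def[abs_def])
qed

lemma continuous_potential: "continuous_on UNIV potential"
  unfolding potential_def[abs_def] barrier_def by (intro continuous_intros) simp_all

sublocale convex_hypersurface "Suc n" potential gradient "real n + 1"
proof
  show "(\<Sum>i\<le>Suc n. (p i)\<^sup>2) \<le> potential p" for p
    using mult_nonneg_nonneg[OF less_imp_le[OF barrier_weight_pos] sum_barrier_nonneg]
    by (simp add: potential_def)
  show "\<exists>p. potential p < real n + 1"
    using potential_corner_point[of "{}"] complex unfolding abstract_simplicial_complex_def by blast
qed (rule continuous_potential elementary_gradient potential_strongly_convex)+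

abbreviation manifold :: "(nat \<Rightarrow> real) topology" where
  "manifold \<equiv> top_of_set hypersurface"

abbreviation coordinate :: "nat \<Rightarrow> (nat \<Rightarrow> real) \<Rightarrow> real" where
  "coordinate \<equiv> \<lambda>j p. p j"

section \<open>Faces of the model\<close>

lemma corner_domain_eq:
  "corner_domain manifold n coordinate = {p \<in> hypersurface. \<forall>j\<in>{1..n}. 0 \<le> p j}"
  by (auto simp: corner_domain_def)

lemma face_eq:
  "face manifold n coordinate J =
    {p. (\<forall>i>Suc n. p i = 0) \<and> potential p = real n + 1
      \<and> (\<forall>j\<in>{1..n}. 0 \<le> p j) \<and> (\<forall>j\<in>J. p j = 0)}"
  unfolding face_def hyperface_def corner_domain_eq by (auto simp: hypersurface_def)

lemma face_subset: "face manifold n coordinate J \<subseteq> hypersurface"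
  by (auto simp: face_def corner_domain_eq)

text \<open>The projection of the face \<open>J\<close> that forgets the two end coordinates. It is convex; the face is recovered by
  attaching over each point \<open>s\<close> the circle of radius \<open>sqrt (n + 1 - potential s)\<close>, which may degenerate to a point.\<close>

definition face_base :: "nat set \<Rightarrow> (nat \<Rightarrow> real) set" where
  "face_base J = {s. (\<forall>i. i \<notin> {1..n} \<longrightarrow> s i = 0) \<and> (\<forall>j\<in>{1..n}. 0 \<le> s j)
    \<and> (\<forall>j\<in>J. s j = 0) \<and> potential s \<le> real n + 1}"

definition revolve :: "(nat \<Rightarrow> real) \<times> real \<Rightarrow> nat \<Rightarrow> real" where
  "revolve = (\<lambda>(s, \<theta>). s(0 := sqrt (real n + 1 - potential s) * cos \<theta>,
    Suc n := sqrt (real n + 1 - potential s) * sin \<theta>))"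

lemma potential_upd_ends:
  assumes "s 0 = 0" "s (Suc n) = 0"
  shows "potential (s(0 := a, Suc n := b)) = potential s + a\<^sup>2 + b\<^sup>2"
proof -
  have "{..Suc n} = {0, Suc n} \<union> {1..n}"
    by auto
  then have split: "(\<Sum>i\<le>Suc n. (p i)\<^sup>2) = (p 0)\<^sup>2 + (p (Suc n))\<^sup>2 + (\<Sum>i\<in>{1..n}. (p i)\<^sup>2)"
    for p :: "nat \<Rightarrow> real"
    by (simp add: sum.union_disjoint)
  have "barrier A (s(0 := a, Suc n := b)) = barrier A s" if "A \<in> nonfaces" for A
  proof -
    have "(\<Sum>j\<in>A. (s(0 := a, Suc n := b)) j) = (\<Sum>j\<in>A. s j)"
      using nonface_subset[OF that] by (intro sum.cong) auto
    then show ?thesis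
      unfolding barrier_def by simp
  qed
  then show ?thesis
    unfolding potential_def split using assms by simp
qed

lemma revolve_face_base:
  assumes "J \<subseteq> {1..n}"
  shows "revolve ` (face_base J \<times> UNIV) = face manifold n coordinate J"
proof (intro equalityI subsetI)
  fix p assume "p \<in> revolve ` (face_base J \<times> UNIV)"
  then obtain s \<theta> where s: "s \<in> face_base J" and p: "p = revolve (s, \<theta>)"
    by auto
  have "0 \<notin> {1..n}" "Suc n \<notin> {1..n}"
    by auto
  then have ends: "s 0 = 0" "s (Suc n) = 0"
    using s unfolding face_base_def by blast+
  let ?r = "sqrt (real n + 1 - potential s)"
  have "(?r * cos \<theta>)\<^sup>2 + (?r * sin \<theta>)\<^sup>2 = ?r\<^sup>2 * ((cos \<theta>)\<^sup>2 + (sin \<theta>)\<^sup>2)"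
    by (simp only: power_mult_distrib distrib_left)
  also have "\<dots> = real n + 1 - potential s"
    using s by (simp add: face_base_def)
  finally have "potential p = real n + 1"
    unfolding p revolve_def prod.case potential_upd_ends[OF ends] by linarith
  then show "p \<in> face manifold n coordinate J"
    using s assms by (auto simp: face_eq p revolve_def face_base_def)
next
  fix p assume p: "p \<in> face manifold n coordinate J"
  define s where "s = p(0 := 0, Suc n := 0)"
  define r where "r = sqrt (real n + 1 - potential s)"
  have restore: "p = s(0 := p 0, Suc n := p (Suc n))"
    by (auto simp: s_def)
  have pot: "potential s + (p 0)\<^sup>2 + (p (Suc n))\<^sup>2 = real n + 1"
    using p potential_upd_ends[of s "p 0" "p (Suc n)"] restore
    by (simp add: face_eq s_def)
  have "potential s \<le> real n + 1"
    using pot zero_le_power2[of "p 0"] zero_le_power2[of "p (Suc n)"] by linarith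
  then have "s \<in> face_base J"
    using p assms by (auto simp: face_base_def face_eq s_def)
  have rr: "r\<^sup>2 = (p 0)\<^sup>2 + (p (Suc n))\<^sup>2"
    using pot \<open>potential s \<le> real n + 1\<close> by (simp add: r_def)
  obtain \<theta> where \<theta>: "p 0 = r * cos \<theta>" "p (Suc n) = r * sin \<theta>"
  proof (cases "r = 0")
    case True
    then have "p 0 = 0" "p (Suc n) = 0"
      using rr by (simp_all add: sum_power2_eq_zero_iff)
    then show ?thesis
      using that[of 0] True by simp
  next
    case False
    then have "(p 0 / r)\<^sup>2 + (p (Suc n) / r)\<^sup>2 = 1"
      by (simp add: power_divide add_divide_distrib[symmetric] rr[symmetric])
    then obtain t where "p 0 / r = cos t" "p (Suc n) / r = sin t"
      using sincos_total_2pi by metis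
    then show ?thesis
      using that[of t] False by (simp add: field_simps)
  qed
  have "p = revolve (s, \<theta>)"
    unfolding revolve_def prod.case r_def[symmetric] \<theta>[symmetric] by (rule restore)
  then show "p \<in> revolve ` (face_base J \<times> UNIV)"
    using \<open>s \<in> face_base J\<close> by blast
qed

lemma connected_face_base: "connected (face_base J)"
proof (rule path_connected_imp_connected, unfold path_connected_def, intro ballI)
  fix p q assume pq: "p \<in> face_base J" "q \<in> face_base J"
  define g where "g t = (\<lambda>i. (1 - t) * p i + t * q i)" for t :: real
  have "path g"
    unfolding path_def g_def
    by (intro continuous_on_coordinatewise_then_product continuous_intros)
  moreover have "g t \<in> face_base J" if t: "t \<in> {0..1}" for t
  proof -
    have "potential (g t) \<le> (1 - t) * potential p + t * potential q"
      unfolding g_def using t by (intro convex_along_segment) auto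
    also have "\<dots> \<le> (1 - t) * (real n + 1) + t * (real n + 1)"
      using pq t by (intro add_mono mult_left_mono) (auto simp: face_base_def)
    also have "\<dots> = real n + 1"
      by (simp add: algebra_simps)
    finally show ?thesis
      using pq t by (auto simp: face_base_def g_def)
  qed
  then have "path_image g \<subseteq> face_base J"
    by (auto simp: path_image_def)
  ultimately show "\<exists>g. path g \<and> path_image g \<subseteq> face_base J \<and> pathstart g = p \<and> pathfinish g = q"
    by (intro exI[of _ g]) (simp add: pathstart_def pathfinish_def g_def)
qed

lemma continuous_on_revolve: "continuous_on S revolve"
proof (rule continuous_on_coordinatewise_then_product)
  fix i
  have pot: "continuous_on S (\<lambda>x. potential (fst x))"
    by (intro continuous_on_compose2[OF continuous_potential] continuous_intros) simp
  have "continuous_on S (\<lambda>x. fst x i)"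
    by (rule continuous_on_product_then_coordinatewise) (intro continuous_intros)
  then have "continuous_on S (\<lambda>x. if i = Suc n then sqrt (real n + 1 - potential (fst x)) * sin (snd x)
      else if i = 0 then sqrt (real n + 1 - potential (fst x)) * cos (snd x) else fst x i)"
    by (cases "i = Suc n"; cases "i = 0") (simp_all, (intro continuous_intros pot)+)
  then show "continuous_on S (\<lambda>x. revolve x i)"
    by (simp add: revolve_def case_prod_beta fun_upd_def)
qed

theorem faces_connected: "all_faces_connected manifold n coordinate"
proof -
  have "connected (face manifold n coordinate J)" if "J \<subseteq> {1..n}" for J
    unfolding revolve_face_base[OF that, symmetric]
    by (intro connected_continuous_image continuous_on_revolve connected_Times
        connected_face_base connected_UNIV)
  then show ?thesis
    using face_subset by (simp add: all_faces_connected_def connectedin_subtopology)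
qed

lemma face_nonempty_imp_simplex:
  assumes "J \<subseteq> {1..n}" "p \<in> face manifold n coordinate J"
  shows "J \<in> L"
proof (rule ccontr)
  assume "J \<notin> L"
  then have "real n + 1 < potential p"
    using assms by (intro potential_on_nonface[of J]) (auto simp: nonfaces_def face_eq)
  then show False
    using assms(2) by (simp add: face_eq)
qed

lemma simplex_imp_face_point:
  assumes "J \<in> L"
  obtains p where "p \<in> face manifold n coordinate J" "\<And>j. j \<in> {1..n} - J \<Longrightarrow> p j = 1"
proof -
  have J: "J \<subseteq> {1..n}"
    using assms complex unfolding abstract_simplicial_complex_def by blast
  have "corner_point J \<in> face_base J"
    using less_imp_le[OF potential_corner_point[OF assms]] by (auto simp: face_base_def corner_point_def)
  then have "revolve (corner_point J, 0) \<in> face manifold n coordinate J"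
    using revolve_face_base[OF J] by blast
  moreover have "revolve (corner_point J, 0) j = 1" if "j \<in> {1..n} - J" for j
    using that by (auto simp: revolve_def corner_point_def)
  ultimately show ?thesis
    using that by blast
qed

lemma face_nonempty_iff: "J \<subseteq> {1..n} \<Longrightarrow> face manifold n coordinate J \<noteq> {} \<longleftrightarrow> J \<in> L"
  using face_nonempty_imp_simplex simplex_imp_face_point by blast

lemma face_singleton: "face manifold n coordinate {j} = hyperface manifold n coordinate j"
  by (auto simp: face_def hyperface_def)

lemma inj_on_hyperface: "inj_on (hyperface manifold n coordinate) {1..n}"
proof (rule inj_onI, rule ccontr)
  fix i j assume ij: "i \<in> {1..n}" "j \<in> {1..n}" "i \<noteq> j"
    and eq: "hyperface manifold n coordinate i = hyperface manifold n coordinate j"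
  have "{i} \<in> L"
    using complex ij(1) unfolding abstract_simplicial_complex_def by blast
  then obtain p where p: "p \<in> hyperface manifold n coordinate i" "\<And>j. j \<in> {1..n} - {i} \<Longrightarrow> p j = 1"
    using simplex_imp_face_point unfolding face_singleton[symmetric] by blast
  have "p \<in> hyperface manifold n coordinate j"
    using p(1) unfolding eq .
  then show False
    using p(2)[of j] ij by (simp add: hyperface_def)
qed

text \<open>For the transversality of the face \<open>J\<close>, the interior point fed into \<open>nonzero_gradient\<close> is \<open>corner_point J\<close>: it
  agrees with the points of the face on \<open>J\<close>, so the non-zero entry of the gradient lies outside \<open>J\<close>.\<close>

theorem embedded_corners:
  "compact_manifold_with_embedded_corners manifold (Suc n) atlas n coordinate"
  unfolding compact_manifold_with_embedded_corners_def
proof (intro conjI ballI allI impI)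
  have "face manifold n coordinate {} = corner_domain manifold n coordinate"
    by (simp add: face_def)
  then show "corner_domain manifold n coordinate \<noteq> {}"
    using face_nonempty_iff[of "{}"] complex unfolding abstract_simplicial_complex_def by simp
  show "hyperface manifold n coordinate j \<noteq> {}" if "j \<in> {1..n}" for j
    using face_nonempty_iff[of "{j}"] that complex
    unfolding abstract_simplicial_complex_def face_singleton by simp
  show "differentials_independent_at (Suc n) atlas coordinate J p"
    if J: "J \<subseteq> {1..n}" and p: "p \<in> face manifold n coordinate J" for J p
  proof -
    obtain l where l: "l \<le> Suc n" "gradient l p \<noteq> 0" "corner_point J l \<noteq> p l"
      using nonzero_gradient[OF subsetD[OF face_subset p]
          potential_corner_point[OF face_nonempty_imp_simplex[OF J p]]] by blast
    then have "l \<notin> J"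
      using p J by (auto simp: face_eq corner_point_def)
    moreover have "J \<subseteq> {..Suc n}"
      using J by fastforce
    ultimately show ?thesis
      using coordinate_differentials_independent[of J l p] l finite_subset[OF J] by simp
  qed
qed (rule smooth_manifold_hypersurface compact_space_hypersurface smooth_function_coordinate)+

theorem corner_simplices_iff:
  assumes "J \<subseteq> {1..n}"
  shows "hyperface manifold n coordinate ` J \<in> corner_simplices manifold n coordinate \<longleftrightarrow> J \<in> L"
  using face_nonempty_iff[OF assms] assms
  by (auto simp: corner_simplices_def corner_vertices_def face_def)

end

section \<open>Realising a simplicial complex\<close>

theorem theorem2p6:
  fixes V :: "'v set" and K :: "'v set set"
  assumes "abstract_simplicial_complex V K" and "finite V"
  shows "\<exists>(M :: (nat \<Rightarrow> real) topology) d \<A> n \<rho>.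
    compact_manifold_with_embedded_corners M d \<A> n \<rho> \<and>
    all_faces_connected M n \<rho> \<and>
    simplicial_isomorphic (corner_vertices M n \<rho>) (corner_simplices M n \<rho>) V K"
proof -
  define n where "n = card V"
  obtain b where b: "bij_betw b {1..n} V"
    using ex_bij_betw_nat_finite_1[OF assms(2)] by (auto simp: n_def)
  define L where "L = {J. J \<subseteq> {1..n} \<and> b ` J \<in> K}"
  have "abstract_simplicial_complex {1..n} L"
    unfolding abstract_simplicial_complex_def
  proof (intro conjI ballI allI impI)
    fix A B assume A: "A \<in> L" and B: "B \<subseteq> A"
    have "b ` A \<in> K"
      using A by (simp add: L_def)
    then have "b ` B \<in> K"
      using assms(1) image_mono[OF B, of b] by (simp add: abstract_simplicial_complex_def)
    then show "B \<in> L"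
      using A B by (auto simp: L_def)
  next
    fix j assume j: "j \<in> {1..n}"
    then have "b j \<in> V"
      using b by (auto simp: bij_betw_def)
    then show "{j} \<in> L"
      using assms(1) j by (auto simp: abstract_simplicial_complex_def L_def)
  qed (use assms(1) finite_subset in \<open>auto simp: abstract_simplicial_complex_def L_def\<close>)
  then interpret labelled_complex n L
    by unfold_locales
  let ?H = "hyperface manifold n coordinate"
  have H: "bij_betw ?H {1..n} (corner_vertices manifold n coordinate)"
    unfolding bij_betw_def corner_vertices_def using inj_on_hyperface by blast
  have "simplicial_isomorphic (corner_vertices manifold n coordinate)
      (corner_simplices manifold n coordinate) V K"
    unfolding simplicial_isomorphic_def
  proof (intro exI conjI allI impI)
    let ?f = "b \<circ> inv_into {1..n} ?H"
    show "bij_betw ?f (corner_vertices manifold n coordinate) V"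
      by (rule bij_betw_trans[OF bij_betw_inv_into[OF H] b])
    fix A assume "A \<subseteq> corner_vertices manifold n coordinate"
    then obtain J where J: "J \<subseteq> {1..n}" "A = ?H ` J"
      unfolding corner_vertices_def by (auto simp: subset_image_iff)
    have "inv_into {1..n} ?H ` (?H ` J) = J"
      using inj_on_hyperface J(1) by (rule inv_into_image_cancel)
    then have "?f ` A = b ` J"
      by (simp only: J(2) image_comp[symmetric])
    moreover have "J \<in> L \<longleftrightarrow> b ` J \<in> K"
      using J(1) by (simp add: L_def)
    ultimately show "A \<in> corner_simplices manifold n coordinate \<longleftrightarrow> ?f ` A \<in> K"
      unfolding J(2) using corner_simplices_iff[OF J(1)] by (simp only:)
  qed
  then show ?thesis
    using embedded_corners faces_connected
    by (intro exI[of _ manifold] exI[of _ "Suc n"] exI[of _ atlas] exI[of _ n]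
        exI[of _ coordinate] conjI)
qed

end
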